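(* 1. Let $(c,d)\in\mathcal S$ and let $I^*=(I^{*,+},I^{*,-})\in\mathcal I$ be an optimal control, i.e. $v(c,d)=G(c,d;I^* )$. Define the stopping times $$\sigma^*:=\inf\{t\ge0: I^{*,-}_t>0\},\qquad\tau^*:=\inf\{t\ge0: I^{*,+}_t>0\}.$$ Then $(\sigma^*,\tau^* )\in\mathcal T\times\mathcal T$ is a saddle point for the associated Dynkin game, i.e. $$J(c,d;\sigma^*,\tau)\le J(c,d;\sigma^*,\tau^* )\le J(c,d;\sigma,\tau^* )\qquad\forall\sigma\in\mathcal T,\ \forall\tau\in\mathcal T.$$ 2. $v$ is differentiable with respect to $c$ in $\mathcal S$ and $v_c=w$ on $\mathcal S$, where $w$ is the (well-defined) value of the associated Dynkin game.
   Context: Setting. $(\Omega,\mathcal F,\mathbb P)$ is a probability space with a filtration $\mathbb F=(\mathcal F_t)_{t\ge 0}$ satisfying the usual conditions and supporting a standard one-dimensional Brownian motion $W$. Let $\mathcal O=(d_{\min},d_{\max})$ with $-\infty\le d_{\min}<d_{\max}\le\infty$ and $\mathcal S=\mathbb R\times\mathcal O$. Demand: $\mathrm dD_t=\mu(D_t)\mathrm dt+\boldsymbol\sigma(D_t)\mathrm dW_t$, $D_0=d$ (diffusion coefficient written $\boldsymbol\sigma$ to distinguish it from the stopping time $\sigma$), where $\mu,\boldsymbol\sigma:\mathcal O\to\mathbb R$ are continuous with at most linear growth; for every $d\in\mathcal O$ there is a unique non-exploding continuous solution $D^d$ with values in $\mathcal O$; if $d_n\to d$ in $\mathcal O$ then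 $D^{d_n}_t\to D^d_t$ a.s. for every $t$; if $d\le d'$ then $D^d_t\le D^{d'}_t$ a.s. for every $t\ge0$; $D$ is a regular diffusion and $d_{\min},d_{\max}$ are natural boundaries (Feller's classification). Cost: $g:\mathcal S\to[0,\infty)$ is continuous, $g(\cdot,d)\in C^1(\mathbb R)$ is convex for every $d$, the partial derivative $g_c$ is continuous on $\mathcal S$, $g_c(c,\cdot)$ is nonincreasing for every $c$, and $|g(c,d)|+|g_c(c,d)|\le\gamma_0(c)+\eta_0(c)|d|^\nu$ for some positive locally bounded $\gamma_0,\eta_0$ and some $\nu\ge0$. $K_0\ge0,K_1\in\mathbb R$ are constants such that $\mathbb E|D^d_t|^\nu\le K_0(1+|d|^\nu)e^{K_1t}$ for all $t,d$ (they exist by linear growth), and $\rho>\max(K_1,0)$. The constants $q_0^+,q_0^-$ are in $(0,\infty)$. Controls: $\mathcal I$ is the set of càdlàg $\mathbb F$-adapted processes $I$ of bounded variation on bounded time intervals, with $I_{0^-}=0$; $I=I^+-I^-$ is the minimal decomposition ($I^\pm$ the positive/negative variations), also written $I=(I^+,I^-)$. Capacity: $C^{c,I}_t=c+I_t$. Define $$G(c,d;I)=\mathbb E\Big[\int_0^\infty e^{-\rho t}\big(g(C^{c,I}_t,D^d_t)\mathrm dt+q_0^+\mathrm dI^+_t+q_0^-\mathrm dI^-_t\big)\Big]$$ (a jump at time $0$ is counted), and $v(c,d)=\inf_{I\in\mathcal I}G(c,d;I)$. It is known that an optimal control exists for every $(c,d)\in\mathcal S$. Associated Dynkin game: $\mathcal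 T$ is the set of all $\mathbb F$-stopping times (with values in $[0,\infty]$); for $\sigma,\tau\in\mathcal T$, $$J(c,d;\sigma,\tau)=\mathbb E\Big[\int_0^{\sigma\wedge\tau}e^{-\rho t}g_c(c,D^d_t)\mathrm dt+q_0^-e^{-\rho\sigma}\mathbf 1_{\{\sigma<\tau\}}-q_0^+e^{-\rho\tau}\mathbf 1_{\{\tau<\sigma\}}\Big].$$ The game has a value $w(c,d)$ if $\sup_{\tau\in\mathcal T}\inf_{\sigma\in\mathcal T}J(c,d;\sigma,\tau)=\inf_{\sigma\in\mathcal T}\sup_{\tau\in\mathcal T}J(c,d;\sigma,\tau)=:w(c,d)$. Convention $\inf\emptyset=\infty$. *)

theory Defs
  imports "HOL-Probability.Probability"
begin

section \<open>Filtrations and Brownian motion\<close>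

text \<open>
  Filtrations are indexed by \<^typ>\<open>ennreal\<close>, so that the library's \<^const>\<open>stopping_time\<close> is the
  notion of a stopping time with values in \<open>[0,\<infinity>]\<close>: its condition at \<open>t = \<infinity>\<close> is vacuous. Processes
  are functions of a real time, of which only the values at \<open>t \<ge> 0\<close> are relevant.
\<close>

definition usual_conditions :: "'a measure \<Rightarrow> (ennreal \<Rightarrow> 'a measure) \<Rightarrow> bool" where
  "usual_conditions M F \<longleftrightarrow>
     (\<forall>N\<in>null_sets M. \<forall>A. A \<subseteq> N \<longrightarrow> A \<in> sets (F 0)) \<and>
     (\<forall>t<\<infinity>. sets (F t) = (\<Inter>u\<in>{t<..}. sets (F u)))"

definition adapted :: "(ennreal \<Rightarrow> 'a measure) \<Rightarrow> (real \<Rightarrow> 'a \<Rightarrow> real) \<Rightarrow> bool" where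
  "adapted F X \<longleftrightarrow> (\<forall>t\<ge>0. X t \<in> borel_measurable (F (ennreal t)))"

definition brownian_motion ::
  "'a measure \<Rightarrow> (ennreal \<Rightarrow> 'a measure) \<Rightarrow> (real \<Rightarrow> 'a \<Rightarrow> real) \<Rightarrow> bool" where
  "brownian_motion M F W \<longleftrightarrow>
     adapted F W \<and>
     (AE \<omega> in M. W 0 \<omega> = 0) \<and>
     (AE \<omega> in M. continuous_on {0..} (\<lambda>t. W t \<omega>)) \<and>
     (\<forall>s\<ge>0. \<forall>t>s.
        distributed M lborel (\<lambda>\<omega>. W t \<omega> - W s \<omega>) (normal_density 0 (sqrt (t - s))) \<and>
        prob_space.indep_set M (sets (F (ennreal s)))
          {(\<lambda>\<omega>. W t \<omega> - W s \<omega>) -` B \<inter> space M | B. B \<in> sets borel})"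

section \<open>The Ito integral and the stochastic differential equation\<close>

definition conv_in_prob :: "'a measure \<Rightarrow> (nat \<Rightarrow> 'a \<Rightarrow> real) \<Rightarrow> ('a \<Rightarrow> real) \<Rightarrow> bool" where
  "conv_in_prob M X Z \<longleftrightarrow>
     (\<forall>\<epsilon>>0. (\<lambda>n. measure M {\<omega>\<in>space M. \<bar>X n \<omega> - Z \<omega>\<bar> > \<epsilon>}) \<longlonglongrightarrow> 0)"

definition progressively_measurable ::
  "(ennreal \<Rightarrow> 'a measure) \<Rightarrow> (real \<Rightarrow> 'a \<Rightarrow> real) \<Rightarrow> bool" where
  "progressively_measurable F H \<longleftrightarrow>
     (\<forall>t\<ge>0. (\<lambda>(s, \<omega>). H s \<omega>) \<in>
        borel_measurable (restrict_space borel {0..t} \<Otimes>\<^sub>M F (ennreal t)))"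

text \<open>
  A triple \<open>(n, p, \<xi>)\<close> encodes the simple process that equals \<open>\<xi> i\<close> on \<open>(p i, p (i + 1)]\<close>, \<open>i < n\<close>.
\<close>

type_synonym 'a simple_process = "nat \<times> (nat \<Rightarrow> real) \<times> (nat \<Rightarrow> 'a \<Rightarrow> real)"

definition is_simple_process :: "(ennreal \<Rightarrow> 'a measure) \<Rightarrow> 'a simple_process \<Rightarrow> bool" where
  "is_simple_process F = (\<lambda>(n, p, \<xi>).
     p 0 = 0 \<and> (\<forall>i<n. p i \<le> p (Suc i)) \<and>
     (\<forall>i<n. \<xi> i \<in> borel_measurable (F (ennreal (p i))) \<and>
            (\<exists>B. \<forall>\<omega>\<in>space (F (ennreal (p i))). \<bar>\<xi> i \<omega>\<bar> \<le> B)))"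

definition simple_process :: "'a simple_process \<Rightarrow> real \<Rightarrow> 'a \<Rightarrow> real" where
  "simple_process = (\<lambda>(n, p, \<xi>) s \<omega>. \<Sum>i<n. \<xi> i \<omega> * indicator {p i<..p (Suc i)} s)"

definition simple_integral ::
  "(real \<Rightarrow> 'a \<Rightarrow> real) \<Rightarrow> 'a simple_process \<Rightarrow> real \<Rightarrow> 'a \<Rightarrow> real" where
  "simple_integral W = (\<lambda>(n, p, \<xi>) t \<omega>.
     \<Sum>i<n. \<xi> i \<omega> * (W (min t (p (Suc i))) \<omega> - W (min t (p i)) \<omega>))"

text \<open>
  \<open>is_ito_integral M F W H t Z\<close> says that \<open>Z\<close> is (a version of) the Ito integral
  \<open>\<integral>\<^sub>0\<^sup>t H\<^sub>s dW\<^sub>s\<close> of a progressively measurable integrand with \<open>\<integral>\<^sub>0\<^sup>t H\<^sub>s\<^sup>2 ds < \<infinity>\<close> almost surely.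
\<close>

definition is_ito_integral ::
  "'a measure \<Rightarrow> (ennreal \<Rightarrow> 'a measure) \<Rightarrow> (real \<Rightarrow> 'a \<Rightarrow> real) \<Rightarrow>
   (real \<Rightarrow> 'a \<Rightarrow> real) \<Rightarrow> real \<Rightarrow> ('a \<Rightarrow> real) \<Rightarrow> bool" where
  "is_ito_integral M F W H t Z \<longleftrightarrow>
     progressively_measurable F H \<and>
     (AE \<omega> in M. (\<integral>\<^sup>+s\<in>{0..t}. ennreal ((H s \<omega>)\<^sup>2) \<partial>lborel) < \<infinity>) \<and>
     Z \<in> borel_measurable M \<and>
     (\<exists>S :: nat \<Rightarrow> 'a simple_process.
        (\<forall>n. is_simple_process F (S n)) \<and>
        (\<forall>\<epsilon>>0. (\<lambda>n. measure M {\<omega>\<in>space M.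
           (\<integral>\<^sup>+s\<in>{0..t}. ennreal ((simple_process (S n) s \<omega> - H s \<omega>)\<^sup>2) \<partial>lborel) > ennreal \<epsilon>})
           \<longlonglongrightarrow> 0) \<and>
        conv_in_prob M (\<lambda>n. simple_integral W (S n) t) Z)"

definition sde_solution ::
  "'a measure \<Rightarrow> (ennreal \<Rightarrow> 'a measure) \<Rightarrow> (real \<Rightarrow> 'a \<Rightarrow> real) \<Rightarrow> real set \<Rightarrow>
   (real \<Rightarrow> real) \<Rightarrow> (real \<Rightarrow> real) \<Rightarrow> real \<Rightarrow> (real \<Rightarrow> 'a \<Rightarrow> real) \<Rightarrow> bool" where
  "sde_solution M F W Dom \<mu> \<Sigma> d X \<longleftrightarrow>
     adapted F X \<and>
     (\<forall>\<omega>\<in>space M. continuous_on {0..} (\<lambda>t. X t \<omega>)) \<and>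
     (\<forall>\<omega>\<in>space M. \<forall>t\<ge>0. X t \<omega> \<in> Dom) \<and>
     (AE \<omega> in M. X 0 \<omega> = d) \<and>
     (\<forall>t\<ge>0. is_ito_integral M F W (\<lambda>s \<omega>. \<Sigma> (X s \<omega>)) t
        (\<lambda>\<omega>. X t \<omega> - d - (LINT s:{0..t}|lborel. \<mu> (X s \<omega>))))"

section \<open>Regular diffusions and Feller's natural boundaries\<close>

definition open_interval :: "ereal \<Rightarrow> ereal \<Rightarrow> real set" where
  "open_interval l r = {x. l < ereal x \<and> ereal x < r}"

definition hitting_time :: "(real \<Rightarrow> 'a \<Rightarrow> real) \<Rightarrow> real \<Rightarrow> 'a \<Rightarrow> ennreal" where
  "hitting_time X y \<omega> = Inf {ennreal t | t. 0 \<le> t \<and> X t \<omega> = y}"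

text \<open>Below, \<open>D x\<close> is the diffusion started at \<open>x\<close>.\<close>

definition regular_diffusion ::
  "'a measure \<Rightarrow> real set \<Rightarrow> (real \<Rightarrow> real \<Rightarrow> 'a \<Rightarrow> real) \<Rightarrow> bool" where
  "regular_diffusion M Dom D \<longleftrightarrow>
     (\<forall>x\<in>Dom. \<forall>y\<in>Dom. measure M {\<omega>\<in>space M. hitting_time (D x) y \<omega> < \<infinity>} > 0)"

definition scale_function ::
  "'a measure \<Rightarrow> real set \<Rightarrow> (real \<Rightarrow> real \<Rightarrow> 'a \<Rightarrow> real) \<Rightarrow> (real \<Rightarrow> real) \<Rightarrow> bool" where
  "scale_function M Dom D s \<longleftrightarrow>
     continuous_on Dom s \<and> strict_mono_on Dom s \<and>
     (\<forall>a\<in>Dom. \<forall>b\<in>Dom. \<forall>x\<in>{a<..<b}.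
        measure M {\<omega>\<in>space M. hitting_time (D x) b \<omega> < hitting_time (D x) a \<omega>}
          = (s x - s a) / (s b - s a))"

text \<open>
  The speed measure is characterised through the mean exit times from \<open>(a,b)\<close>, expressed with the
  Green function of the diffusion killed on leaving \<open>(a,b)\<close>. For an equation with smooth scale
  function this normalisation gives \<open>2 / (\<Sigma>(y)\<^sup>2 s'(y)) dy\<close>.
\<close>

definition speed_measure ::
  "'a measure \<Rightarrow> real set \<Rightarrow> (real \<Rightarrow> real \<Rightarrow> 'a \<Rightarrow> real) \<Rightarrow> (real \<Rightarrow> real) \<Rightarrow> real measure \<Rightarrow> bool"
  where
  "speed_measure M Dom D s m \<longleftrightarrow>
     sets m = sets borel \<and>
     (\<forall>a\<in>Dom. \<forall>b\<in>Dom. \<forall>x\<in>{a<..<b}.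
        (\<integral>\<^sup>+\<omega>. min (hitting_time (D x) a \<omega>) (hitting_time (D x) b \<omega>) \<partial>M)
          = (\<integral>\<^sup>+y\<in>{a<..<b}.
               ennreal ((s (min x y) - s a) * (s b - s (max x y)) / (s b - s a)) \<partial>m))"

text \<open>
  An end point is natural if it is neither an exit nor an entrance boundary. For the left end point
  \<open>l\<close> the two Feller integrals over \<open>(l,z)\<close> have the integrands \<open>s(y) - s(l+)\<close> (finite integral iff
  \<open>l\<close> is attainable) and \<open>s(z) - s(y)\<close> (finite integral iff the diffusion can be started at \<open>l\<close>)
  with respect to \<open>m(dy)\<close>; the right end point is symmetric. The suprema below are \<open>s(y) - s(l+)\<close>
  and \<open>s(r-) - s(y)\<close>, possibly infinite.
\<close>

definition natural_left :: "real set \<Rightarrow> (real \<Rightarrow> real) \<Rightarrow> real measure \<Rightarrow> bool" where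
  "natural_left Dom s m \<longleftrightarrow> (\<forall>z\<in>Dom.
     (\<integral>\<^sup>+y\<in>Dom \<inter> {..<z}. (SUP a\<in>Dom. ennreal (s y - s a)) \<partial>m) = \<infinity> \<and>
     (\<integral>\<^sup>+y\<in>Dom \<inter> {..<z}. ennreal (s z - s y) \<partial>m) = \<infinity>)"

definition natural_right :: "real set \<Rightarrow> (real \<Rightarrow> real) \<Rightarrow> real measure \<Rightarrow> bool" where
  "natural_right Dom s m \<longleftrightarrow> (\<forall>z\<in>Dom.
     (\<integral>\<^sup>+y\<in>Dom \<inter> {z<..}. (SUP b\<in>Dom. ennreal (s b - s y)) \<partial>m) = \<infinity> \<and>
     (\<integral>\<^sup>+y\<in>Dom \<inter> {z<..}. ennreal (s y - s z) \<partial>m) = \<infinity>)"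

definition natural_boundaries ::
  "'a measure \<Rightarrow> real set \<Rightarrow> (real \<Rightarrow> real \<Rightarrow> 'a \<Rightarrow> real) \<Rightarrow> bool" where
  "natural_boundaries M Dom D \<longleftrightarrow>
     (\<exists>s m. scale_function M Dom D s \<and> speed_measure M Dom D s m \<and>
            natural_left Dom s m \<and> natural_right Dom s m)"

section \<open>The control problem\<close>

text \<open>Extension by \<open>0\<close> to negative times, encoding \<open>f(0-) = 0\<close>.\<close>

definition ext0 :: "(real \<Rightarrow> real) \<Rightarrow> real \<Rightarrow> real" where
  "ext0 f t = (if t < 0 then 0 else f t)"

definition partitions_upto :: "real \<Rightarrow> (nat \<times> (nat \<Rightarrow> real)) set" where
  "partitions_upto t = {(n, p). (\<forall>i<n. p i \<le> p (Suc i)) \<and> p n \<le> t}"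

definition bounded_variation_upto :: "(real \<Rightarrow> real) \<Rightarrow> real \<Rightarrow> bool" where
  "bounded_variation_upto f t \<longleftrightarrow>
     bdd_above ((\<lambda>(n, p). \<Sum>i<n. \<bar>ext0 f (p (Suc i)) - ext0 f (p i)\<bar>) ` partitions_upto t)"

text \<open>
  Positive and negative variation on \<open>[0-, t]\<close>; partition points may be negative, so a jump at time
  \<open>0\<close> is included.
\<close>

definition pos_variation :: "(real \<Rightarrow> real) \<Rightarrow> real \<Rightarrow> real" where
  "pos_variation f t =
     (SUP (n, p)\<in>partitions_upto t. \<Sum>i<n. max 0 (ext0 f (p (Suc i)) - ext0 f (p i)))"

definition neg_variation :: "(real \<Rightarrow> real) \<Rightarrow> real \<Rightarrow> real" where
  "neg_variation f t =
     (SUP (n, p)\<in>partitions_upto t. \<Sum>i<n. max 0 (ext0 f (p i) - ext0 f (p (Suc i))))"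

definition cadlag :: "(real \<Rightarrow> real) \<Rightarrow> bool" where
  "cadlag f \<longleftrightarrow>
     (\<forall>t\<ge>0. continuous (at_right t) f) \<and> (\<forall>t>0. \<exists>l. (f \<longlongrightarrow> l) (at_left t))"

definition controls ::
  "'a measure \<Rightarrow> (ennreal \<Rightarrow> 'a measure) \<Rightarrow> (real \<Rightarrow> 'a \<Rightarrow> real) set" where
  "controls M F = {I. adapted F I \<and>
     (\<forall>\<omega>\<in>space M. cadlag (\<lambda>t. I t \<omega>) \<and> (\<forall>T\<ge>0. bounded_variation_upto (\<lambda>t. I t \<omega>) T))}"

text \<open>In the following two definitions \<open>X\<close> is the demand process \<open>D\<^sup>d\<close>.\<close>

definition total_cost ::
  "'a measure \<Rightarrow> real \<Rightarrow> real \<Rightarrow> real \<Rightarrow> (real \<Rightarrow> real \<Rightarrow> real) \<Rightarrow> (real \<Rightarrow> 'a \<Rightarrow> real) \<Rightarrow>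
   real \<Rightarrow> (real \<Rightarrow> 'a \<Rightarrow> real) \<Rightarrow> ennreal" where
  "total_cost M \<rho> qp qm g X c I =
     (\<integral>\<^sup>+\<omega>.
        (\<integral>\<^sup>+t\<in>{0..}. ennreal (exp (- \<rho> * t) * g (c + I t \<omega>) (X t \<omega>)) \<partial>lborel)
        + ennreal qp * (\<integral>\<^sup>+t\<in>{0..}. ennreal (exp (- \<rho> * t))
            \<partial>interval_measure (ext0 (pos_variation (\<lambda>t. I t \<omega>))))
        + ennreal qm * (\<integral>\<^sup>+t\<in>{0..}. ennreal (exp (- \<rho> * t))
            \<partial>interval_measure (ext0 (neg_variation (\<lambda>t. I t \<omega>)))) \<partial>M)"

definition value_fun ::
  "'a measure \<Rightarrow> (ennreal \<Rightarrow> 'a measure) \<Rightarrow> real \<Rightarrow> real \<Rightarrow> real \<Rightarrow> (real \<Rightarrow> real \<Rightarrow> real) \<Rightarrow>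
   (real \<Rightarrow> real \<Rightarrow> 'a \<Rightarrow> real) \<Rightarrow> real \<Rightarrow> real \<Rightarrow> ennreal" where
  "value_fun M F \<rho> qp qm g D c d = (INF I\<in>controls M F. total_cost M \<rho> qp qm g (D d) c I)"

section \<open>The associated Dynkin game\<close>

definition discount :: "real \<Rightarrow> ennreal \<Rightarrow> real" where
  "discount \<rho> s = (if s = \<infinity> then 0 else exp (- \<rho> * enn2real s))"

definition dynkin_payoff ::
  "'a measure \<Rightarrow> real \<Rightarrow> real \<Rightarrow> real \<Rightarrow> (real \<Rightarrow> real \<Rightarrow> real) \<Rightarrow> (real \<Rightarrow> 'a \<Rightarrow> real) \<Rightarrow>
   real \<Rightarrow> ('a \<Rightarrow> ennreal) \<Rightarrow> ('a \<Rightarrow> ennreal) \<Rightarrow> real" where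
  "dynkin_payoff M \<rho> qp qm gc X c \<sigma> \<tau> =
     (LINT \<omega>|M.
        (LINT t:{t. 0 \<le> t \<and> ennreal t \<le> min (\<sigma> \<omega>) (\<tau> \<omega>)}|lborel. exp (- \<rho> * t) * gc c (X t \<omega>))
        + (if \<sigma> \<omega> < \<tau> \<omega> then qm * discount \<rho> (\<sigma> \<omega>) else 0)
        - (if \<tau> \<omega> < \<sigma> \<omega> then qp * discount \<rho> (\<tau> \<omega>) else 0))"

definition dynkin_lower ::
  "'a measure \<Rightarrow> (ennreal \<Rightarrow> 'a measure) \<Rightarrow> real \<Rightarrow> real \<Rightarrow> real \<Rightarrow> (real \<Rightarrow> real \<Rightarrow> real) \<Rightarrow>
   (real \<Rightarrow> real \<Rightarrow> 'a \<Rightarrow> real) \<Rightarrow> real \<Rightarrow> real \<Rightarrow> ereal" where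
  "dynkin_lower M F \<rho> qp qm gc D c d =
     (SUP \<tau>\<in>{\<tau>. stopping_time F \<tau>}. INF \<sigma>\<in>{\<sigma>. stopping_time F \<sigma>}.
        ereal (dynkin_payoff M \<rho> qp qm gc (D d) c \<sigma> \<tau>))"

definition dynkin_upper ::
  "'a measure \<Rightarrow> (ennreal \<Rightarrow> 'a measure) \<Rightarrow> real \<Rightarrow> real \<Rightarrow> real \<Rightarrow> (real \<Rightarrow> real \<Rightarrow> real) \<Rightarrow>
   (real \<Rightarrow> real \<Rightarrow> 'a \<Rightarrow> real) \<Rightarrow> real \<Rightarrow> real \<Rightarrow> ereal" where
  "dynkin_upper M F \<rho> qp qm gc D c d =
     (INF \<sigma>\<in>{\<sigma>. stopping_time F \<sigma>}. SUP \<tau>\<in>{\<tau>. stopping_time F \<tau>}.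
        ereal (dynkin_payoff M \<rho> qp qm gc (D d) c \<sigma> \<tau>))"

definition dynkin_has_value ::
  "'a measure \<Rightarrow> (ennreal \<Rightarrow> 'a measure) \<Rightarrow> real \<Rightarrow> real \<Rightarrow> real \<Rightarrow> (real \<Rightarrow> real \<Rightarrow> real) \<Rightarrow>
   (real \<Rightarrow> real \<Rightarrow> 'a \<Rightarrow> real) \<Rightarrow> real \<Rightarrow> real \<Rightarrow> real \<Rightarrow> bool" where
  "dynkin_has_value M F \<rho> qp qm gc D c d w \<longleftrightarrow>
     dynkin_lower M F \<rho> qp qm gc D c d = ereal w \<and>
     dynkin_upper M F \<rho> qp qm gc D c d = ereal w"

definition first_positive_time :: "(real \<Rightarrow> real) \<Rightarrow> ennreal" where
  "first_positive_time f = Inf {ennreal t | t. 0 \<le> t \<and> f t > 0}"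

section \<open>Standing assumptions\<close>

text \<open>\<open>|x|\<^sup>\<nu>\<close> with \<open>|0|\<^sup>0 = 1\<close>, whereas \<open>0 powr 0 = 0\<close>.\<close>

definition abs_pow :: "real \<Rightarrow> real \<Rightarrow> real" where
  "abs_pow x \<nu> = (if \<nu> = 0 then 1 else \<bar>x\<bar> powr \<nu>)"

definition locally_bounded :: "(real \<Rightarrow> real) \<Rightarrow> bool" where
  "locally_bounded f \<longleftrightarrow> (\<forall>x. \<exists>U. open U \<and> x \<in> U \<and> bounded (f ` U))"

locale capacity_setting = prob_space M + filtration "space M" F
  for M :: "'a measure" and F :: "ennreal \<Rightarrow> 'a measure" +
  fixes W :: "real \<Rightarrow> 'a \<Rightarrow> real"
    and dmin dmax :: ereal
    and \<mu> \<Sigma> :: "real \<Rightarrow> real"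
    and D :: "real \<Rightarrow> real \<Rightarrow> 'a \<Rightarrow> real"
    and g gc :: "real \<Rightarrow> real \<Rightarrow> real"
    and \<gamma>0 \<eta>0 :: "real \<Rightarrow> real"
    and \<nu> K0 K1 \<rho> qp qm :: real
  assumes F_sub: "\<And>t. sets (F t) \<subseteq> sets M"
    and usual: "usual_conditions M F"
    and W_BM: "brownian_motion M F W"
    and dmin_dmax: "dmin < dmax"
    and \<mu>_cont: "continuous_on (open_interval dmin dmax) \<mu>"
    and \<Sigma>_cont: "continuous_on (open_interval dmin dmax) \<Sigma>"
    and linear_growth: "\<exists>L. \<forall>x\<in>open_interval dmin dmax. \<bar>\<mu> x\<bar> + \<bar>\<Sigma> x\<bar> \<le> L * (1 + \<bar>x\<bar>)"
    and D_solution: "\<And>d. d \<in> open_interval dmin dmax \<Longrightarrow>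
          sde_solution M F W (open_interval dmin dmax) \<mu> \<Sigma> d (D d)"
    and D_unique: "\<And>d Y. d \<in> open_interval dmin dmax \<Longrightarrow>
          sde_solution M F W (open_interval dmin dmax) \<mu> \<Sigma> d Y \<Longrightarrow>
          (AE \<omega> in M. \<forall>t\<ge>0. Y t \<omega> = D d t \<omega>)"
    and D_continuous: "\<And>x d t. (\<And>n. x n \<in> open_interval dmin dmax) \<Longrightarrow>
          d \<in> open_interval dmin dmax \<Longrightarrow> x \<longlonglongrightarrow> d \<Longrightarrow> 0 \<le> t \<Longrightarrow>
          (AE \<omega> in M. (\<lambda>n. D (x n) t \<omega>) \<longlonglongrightarrow> D d t \<omega>)"
    and D_comparison: "\<And>d d' t. d \<in> open_interval dmin dmax \<Longrightarrow>
          d' \<in> open_interval dmin dmax \<Longrightarrow> d \<le> d' \<Longrightarrow> 0 \<le> t \<Longrightarrow>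
          (AE \<omega> in M. D d t \<omega> \<le> D d' t \<omega>)"
    and D_regular: "regular_diffusion M (open_interval dmin dmax) D"
    and D_natural: "natural_boundaries M (open_interval dmin dmax) D"
    and g_nonneg: "\<And>c d. d \<in> open_interval dmin dmax \<Longrightarrow> 0 \<le> g c d"
    and g_cont: "continuous_on (UNIV \<times> open_interval dmin dmax) (\<lambda>(c, d). g c d)"
    and g_convex: "\<And>d. d \<in> open_interval dmin dmax \<Longrightarrow> convex_on UNIV (\<lambda>c. g c d)"
    and g_deriv: "\<And>c d. d \<in> open_interval dmin dmax \<Longrightarrow>
          ((\<lambda>x. g x d) has_real_derivative gc c d) (at c)"
    and gc_cont: "continuous_on (UNIV \<times> open_interval dmin dmax) (\<lambda>(c, d). gc c d)"
    and gc_antimono: "\<And>c. antimono_on (open_interval dmin dmax) (gc c)"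
    and growth_pos: "\<And>c. \<gamma>0 c > 0" "\<And>c. \<eta>0 c > 0"
    and growth_loc_bdd: "locally_bounded \<gamma>0" "locally_bounded \<eta>0"
    and nu_nonneg: "\<nu> \<ge> 0"
    and g_growth: "\<And>c d. d \<in> open_interval dmin dmax \<Longrightarrow>
          \<bar>g c d\<bar> + \<bar>gc c d\<bar> \<le> \<gamma>0 c + \<eta>0 c * abs_pow d \<nu>"
    and K0_nonneg: "K0 \<ge> 0"
    and D_moments: "\<And>d t. d \<in> open_interval dmin dmax \<Longrightarrow> 0 \<le> t \<Longrightarrow>
          (\<integral>\<^sup>+\<omega>. ennreal (abs_pow (D d t \<omega>) \<nu>) \<partial>M)
            \<le> ennreal (K0 * (1 + abs_pow d \<nu>) * exp (K1 * t))"
    and rho: "\<rho> > max K1 0"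
    and q_pos: "qp > 0" "qm > 0"

end

theory Submission
  imports Defs
begin

text \<open>
  Integration by parts turns the discounted control costs into \<open>\<integral> \<rho> e\<^sup>-\<^sup>\<rho>\<^sup>t (q\<^sup>+ I\<^sup>+\<^sub>t + q\<^sup>- I\<^sup>-\<^sub>t) dt\<close>. Let \<open>I\<close> be
  optimal at \<open>c\<close>, \<open>\<tau>*\<close> its first purchase time and \<open>\<sigma>\<close> any stopping time. Starting from \<open>c + \<epsilon>\<close>, the
  investor follows \<open>I\<close> except that the excess \<open>\<epsilon>\<close> replaces the first purchases of \<open>I\<close>, or is sold at
  time \<open>\<sigma>\<close> if \<open>\<sigma> < \<tau>*\<close>. By convexity of \<open>g\<close> the extra cost is at most \<open>\<epsilon>\<close> times an integral which tends
  to at most \<open>J(c,d;\<sigma>,\<tau>*)\<close>, so the upper right derivative of \<open>v\<close> at \<open>c\<close> is at most \<open>J(c,d;\<sigma>,\<tau>*)\<close>. The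
  reflection \<open>c \<mapsto> -c\<close>, \<open>I \<mapsto> -I\<close> swaps the players and bounds the lower left derivative from below by
  \<open>J(c,d;\<sigma>*,\<tau>)\<close>. Convexity of \<open>v\<close> gives the opposite order of the one-sided derivatives, hence all these
  quantities coincide at \<open>(\<sigma>*,\<tau>*)\<close>.
\<close>

section \<open>Positive and negative variation\<close>

text \<open>The obstacle is that the running payoff of the game has \<open>gc\<close> frozen at the
  initial level \<open>c\<close>, while the optimally controlled capacity moves. Monotonicity of
  \<open>gc\<close> in its first argument removes it: until the purchases of the optimal control
  have used up the excess, the perturbed capacity is \<open>c + \<epsilon> - N\<close>, with
  \<open>N\<close> the negative variation of the optimal control, so its marginal cost is at most
  the one at \<open>c + \<epsilon>\<close>. The same replacement supplies integrability, which is
  available for deterministic levels. With costs and payoffs written as integrals over the product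
  \<open>Q\<close> of the probability with exp(-\<rho> t) dt, comparisons become pointwise: upper
  bounds on the variations of a perturbed control replace its minimal decomposition, and the limit
  in \<epsilon> is dominated convergence. When \<sigma> = \<tau>* the game pays no lump sum, yet the
  perturbation still saves purchases; this is why the limit is bounded by J and need not equal
  it.\<close>

lemma ext0_uminus: "ext0 (\<lambda>s. - f s) t = - ext0 f t"
  by (simp add: ext0_def)

text \<open>Facts about the negative variation are obtained below from those about the positive
  variation of \<open>- f\<close>.\<close>

lemma neg_variation_eq: "neg_variation f = pos_variation (\<lambda>s. - f s)"
  by (rule ext) (simp add: neg_variation_def pos_variation_def ext0_uminus)

lemma pos_variation_uminus: "pos_variation (\<lambda>s. - f s) = neg_variation f"
  by (simp add: neg_variation_eq)

lemma neg_variation_uminus: "neg_variation (\<lambda>s. - f s) = pos_variation f"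
  by (simp add: neg_variation_eq)

lemma bounded_variation_upto_uminus:
  "bounded_variation_upto (\<lambda>s. - f s) t \<longleftrightarrow> bounded_variation_upto f t"
  by (simp add: bounded_variation_upto_def ext0_uminus abs_minus_commute)

lemma trivial_partition: "(0, p) \<in> partitions_upto t \<longleftrightarrow> p 0 \<le> t"
  by (simp add: partitions_upto_def)

lemma partitions_upto_le:
  assumes "(n, p) \<in> partitions_upto t" "i \<le> n"
  shows "p i \<le> t"
proof -
  have "p i \<le> p n" using assms(2)
  proof (induction rule: inc_induct)
    case (step m)
    then have "p m \<le> p (Suc m)" using assms(1) by (simp add: partitions_upto_def)
    then show ?case using step.IH by linarith
  qed simp
  then show ?thesis using assms(1) by (auto simp: partitions_upto_def)
qed

lemma bdd_above_pos_sums: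
  assumes "bounded_variation_upto f t"
  shows "bdd_above ((\<lambda>(n, p). \<Sum>i<n. max 0 (ext0 f (p (Suc i)) - ext0 f (p i))) ` partitions_upto t)"
proof -
  obtain B where B: "\<And>n p. (n, p) \<in> partitions_upto t \<Longrightarrow>
      (\<Sum>i<n. \<bar>ext0 f (p (Suc i)) - ext0 f (p i)\<bar>) \<le> B"
    using assms unfolding bounded_variation_upto_def bdd_above_def by force
  have "(\<Sum>i<n. max 0 (ext0 f (p (Suc i)) - ext0 f (p i))) \<le> B" if "(n, p) \<in> partitions_upto t" for n p
    by (rule order_trans[OF sum_mono B[OF that]]) auto
  then show ?thesis by (intro bdd_aboveI[of _ B]) auto
qed

lemma pos_sum_le_pos_variation:
  assumes "bounded_variation_upto f t" "(n, p) \<in> partitions_upto t"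
  shows "(\<Sum>i<n. max 0 (ext0 f (p (Suc i)) - ext0 f (p i))) \<le> pos_variation f t"
  using cSUP_upper[OF assms(2) bdd_above_pos_sums[OF assms(1)]] by (simp add: pos_variation_def)

lemma pos_variation_least:
  assumes "\<And>n p. (n, p) \<in> partitions_upto t \<Longrightarrow>
      (\<Sum>i<n. max 0 (ext0 f (p (Suc i)) - ext0 f (p i))) \<le> K"
  shows "pos_variation f t \<le> K"
  unfolding pos_variation_def
proof (rule cSUP_least)
  show "partitions_upto t \<noteq> {}"
    using trivial_partition[of "\<lambda>_. t" t] by auto
qed (use assms in auto)

text \<open>Telescoping: increments of \<open>Q\<close> dominate the positive increments, and the
  initial value is dropped by nonnegativity. Jordan's identity, right continuity and the cost bounds
  for constructed controls all come from suitable choices of \<open>Q\<close>.\<close>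

lemma pos_variation_minimal:
  assumes nonneg: "\<And>s. 0 \<le> Q s"
    and step: "\<And>a b. a \<le> b \<Longrightarrow> b \<le> t \<Longrightarrow> max 0 (ext0 f b - ext0 f a) \<le> Q b - Q a"
  shows "pos_variation f t \<le> Q t"
proof (rule pos_variation_least)
  fix n p assume np: "(n, p) \<in> partitions_upto t"
  have "(\<Sum>i<n. max 0 (ext0 f (p (Suc i)) - ext0 f (p i))) \<le> (\<Sum>i<n. Q (p (Suc i)) - Q (p i))"
    by (intro sum_mono step) (use np partitions_upto_le[OF np] in \<open>auto simp: partitions_upto_def\<close>)
  also have "\<dots> = Q (p n) - Q (p 0)" by (rule sum_lessThan_telescope)
  also have "\<dots> \<le> Q (p n)" using nonneg[of "p 0"] by simp
  also have "\<dots> \<le> Q t"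
    using step[of "p n" t] partitions_upto_le[OF np, of n] by auto
  finally show "(\<Sum>i<n. max 0 (ext0 f (p (Suc i)) - ext0 f (p i))) \<le> Q t" .
qed

lemma pos_variation_increment:
  assumes bv: "bounded_variation_upto f b" and ab: "a \<le> b"
  shows "max 0 (ext0 f b - ext0 f a) \<le> pos_variation f b - pos_variation f a"
proof -
  have "pos_variation f a \<le> pos_variation f b - max 0 (ext0 f b - ext0 f a)"
  proof (rule pos_variation_least)
    fix n p assume np: "(n, p) \<in> partitions_upto a"
    \<comment> \<open>Append \<open>a\<close> and \<open>b\<close> to a partition of the time up to
      \<open>a\<close>; the extra term from \<open>p n\<close> to \<open>a\<close> is nonnegative
      and is discarded.\<close>
    define p' where "p' i = (if i \<le> n then p i else if i = Suc n then a else b)" for i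
    have "(Suc (Suc n), p') \<in> partitions_upto b"
      using np ab by (auto simp: partitions_upto_def p'_def less_Suc_eq)
    from pos_sum_le_pos_variation[OF bv this]
    have "(\<Sum>i<n. max 0 (ext0 f (p (Suc i)) - ext0 f (p i))) + max 0 (ext0 f a - ext0 f (p n))
        + max 0 (ext0 f b - ext0 f a) \<le> pos_variation f b"
      by (simp add: p'_def)
    then show "(\<Sum>i<n. max 0 (ext0 f (p (Suc i)) - ext0 f (p i)))
        \<le> pos_variation f b - max 0 (ext0 f b - ext0 f a)" by linarith
  qed
  then show ?thesis by linarith
qed

lemma pos_variation_neg_time: "t < 0 \<Longrightarrow> pos_variation f t = 0"
proof (rule antisym)
  assume t: "t < 0"
  then show "pos_variation f t \<le> 0"
    using pos_variation_minimal[of "\<lambda>_. 0" t f] by (simp add: ext0_def)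
  \<comment> \<open>The supremum is taken in the reals, so even the lower bound by an empty sum
    needs boundedness; before time 0 all increments of \<open>ext0 f\<close> vanish.\<close>
  have "bounded_variation_upto f t"
    unfolding bounded_variation_upto_def
  proof (rule bdd_aboveI[of _ 0], clarify)
    fix n p assume np: "(n, p) \<in> partitions_upto t"
    have "ext0 f (p i) = 0" if "i \<le> n" for i
      using partitions_upto_le[OF np that] t by (simp add: ext0_def)
    then show "(\<Sum>i<n. \<bar>ext0 f (p (Suc i)) - ext0 f (p i)\<bar>) \<le> 0" by simp
  qed
  from pos_sum_le_pos_variation[OF this, of 0 "\<lambda>_. t"] show "0 \<le> pos_variation f t"
    by (simp add: trivial_partition)
qed

lemma neg_variation_neg_time: "t < 0 \<Longrightarrow> neg_variation f t = 0"
  by (simp add: neg_variation_eq pos_variation_neg_time)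

text \<open>Removes \<open>ext0\<close> from the integrators in \<open>total_cost\<close>.\<close>

lemma ext0_pos_variation [simp]: "ext0 (pos_variation f) = pos_variation f"
  by (auto simp: ext0_def fun_eq_iff pos_variation_neg_time)

lemma ext0_neg_variation [simp]: "ext0 (neg_variation f) = neg_variation f"
  by (simp add: neg_variation_eq)

section \<open>Jordan decomposition and right continuity of the variations\<close>

locale bv_path =
  fixes f :: "real \<Rightarrow> real"
  assumes cadlag: "cadlag f" and bv: "\<And>T. 0 \<le> T \<Longrightarrow> bounded_variation_upto f T"
begin

lemma bv_all: "bounded_variation_upto f t"
proof (cases "0 \<le> t")
  case False
  have "partitions_upto t \<subseteq> partitions_upto 0"
    using False by (auto simp: partitions_upto_def)
  then show ?thesis
    using bdd_above_mono[OF bv[OF order_refl, unfolded bounded_variation_upto_def] image_mono]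
    by (simp add: bounded_variation_upto_def)
qed (rule bv)

lemma bv_path_uminus: "bv_path (\<lambda>s. - f s)"
proof
  show "cadlag (\<lambda>s. - f s)"
    using cadlag unfolding cadlag_def by (blast intro: continuous_minus tendsto_minus)
qed (simp add: bounded_variation_upto_uminus bv)

lemma pos_increment: "a \<le> b \<Longrightarrow> max 0 (ext0 f b - ext0 f a) \<le> pos_variation f b - pos_variation f a"
  by (rule pos_variation_increment[OF bv_all])

lemma pos_mono: "mono (pos_variation f)"
proof
  show "pos_variation f a \<le> pos_variation f b" if "a \<le> b" for a b
    using pos_increment[OF that] by linarith
qed

lemma pos_nonneg: "0 \<le> pos_variation f t"
  using monoD[OF pos_mono, of "min (-1) t" t] pos_variation_neg_time[of "min (-1) t" f] by auto

lemma neg_increment: "a \<le> b \<Longrightarrow> max 0 (ext0 f a - ext0 f b) \<le> neg_variation f b - neg_variation f a"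
  using bv_path.pos_increment[OF bv_path_uminus, of a b] by (simp add: pos_variation_uminus ext0_uminus)

lemma neg_mono: "mono (neg_variation f)"
  using bv_path.pos_mono[OF bv_path_uminus] by (simp add: pos_variation_uminus)

lemma neg_nonneg: "0 \<le> neg_variation f t"
  using bv_path.pos_nonneg[OF bv_path_uminus] by (simp add: pos_variation_uminus)

text \<open>The right-hand side is an admissible \<open>Q\<close>: a decrease of
  \<open>ext0 f\<close> is compensated by the negative variation, so it is increasing, and it
  vanishes at negative times. Applied to \<open>f\<close> and to \<open>- f\<close> this gives
  \<open>jordan\<close>.\<close>

lemma pos_le: "pos_variation f t \<le> neg_variation f t + ext0 f t"
proof (rule pos_variation_minimal)
  have incr: "neg_variation f a + ext0 f a \<le> neg_variation f b + ext0 f b" if "a \<le> b" for a b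
    using neg_increment[OF that] by linarith
  show "0 \<le> neg_variation f s + ext0 f s" for s
    using incr[of "min (-1) s" s] neg_variation_neg_time[of "min (-1) s" f]
    by (auto simp: ext0_def min_def split: if_splits)
  show "max 0 (ext0 f b - ext0 f a) \<le> neg_variation f b + ext0 f b - (neg_variation f a + ext0 f a)"
    if "a \<le> b" for a b
    using incr[OF that] neg_increment[OF that] by linarith
qed

lemma jordan: "ext0 f t = pos_variation f t - neg_variation f t"
  using pos_le[of t] bv_path.pos_le[OF bv_path_uminus, of t]
  by (simp add: pos_variation_uminus neg_variation_uminus ext0_uminus)

lemma jordan': "0 \<le> t \<Longrightarrow> f t = pos_variation f t - neg_variation f t"
  using jordan[of t] by (simp add: ext0_def)

lemma ext0_right_cont: "(ext0 f \<longlongrightarrow> ext0 f t) (at_right t)"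
proof (cases "t < 0")
  case True
  have "\<forall>\<^sub>F x in at_right t. ext0 f t = ext0 f x"
    using True by (auto simp: eventually_at_right ext0_def intro!: exI[of _ 0])
  then show ?thesis by (rule Lim_transform_eventually[OF tendsto_const])
next
  case False
  then have "(f \<longlongrightarrow> ext0 f t) (at_right t)"
    using cadlag by (auto simp: cadlag_def continuous_within ext0_def)
  moreover have "\<forall>\<^sub>F x in at_right t. f x = ext0 f x"
    using False by (intro eventually_at_right_less[THEN eventually_mono]) (auto simp: ext0_def)
  ultimately show ?thesis by (rule Lim_transform_eventually)
qed

text \<open>A right jump of the positive variation could be cut out, contradicting minimality.\<close>

lemma pos_right_cont: "continuous (at_right t) (pos_variation f)"
proof -
  define L where "L = Inf (pos_variation f ` {t<..})"
  have lim: "(pos_variation f \<longlongrightarrow> L) (at_right t)"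
    using Lim_right_bound[of UNIV t "pos_variation f" 0] pos_nonneg monoD[OF pos_mono]
    by (auto simp: L_def)
  have L: "L \<le> pos_variation f b" if "t < b" for b
    unfolding L_def by (rule cINF_lower) (use that pos_nonneg in \<open>auto intro: bdd_belowI[of _ 0]\<close>)
  have L': "pos_variation f t \<le> L"
    unfolding L_def by (rule cINF_greatest) (auto intro: monoD[OF pos_mono])
  define j where "j = L - pos_variation f t"
  \<comment> \<open>The positive variation with its right jump at \<open>t\<close> removed;
    \<open>t + 1\<close> below stands for some time after \<open>t\<close>.\<close>
  define Q where "Q s = (if s \<le> t then pos_variation f s else pos_variation f s - j)" for s
  \<comment> \<open>Only increments across \<open>t\<close> are delicate for \<open>Q\<close>. Let
    \<open>s\<close> decrease to \<open>t\<close> in \<open>pos_increment\<close>;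
    \<open>ext0 f\<close> itself does not jump there.\<close>
  have cross: "ext0 f b - ext0 f t \<le> pos_variation f b - L" if "t < b" for b
  proof (rule tendsto_le[OF trivial_limit_at_right_real])
    show "((\<lambda>s. pos_variation f b - pos_variation f s) \<longlongrightarrow> pos_variation f b - L) (at_right t)"
      by (intro tendsto_intros lim)
    show "((\<lambda>s. ext0 f b - ext0 f s) \<longlongrightarrow> ext0 f b - ext0 f t) (at_right t)"
      by (intro tendsto_intros ext0_right_cont)
    show "\<forall>\<^sub>F s in at_right t. ext0 f b - ext0 f s \<le> pos_variation f b - pos_variation f s"
      unfolding eventually_at_right[OF that]
    proof (intro exI[of _ b] conjI allI impI that)
      show "ext0 f b - ext0 f s \<le> pos_variation f b - pos_variation f s" if "t < s" "s < b" for s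
        using pos_increment[of s b] that by linarith
    qed
  qed
  have "pos_variation f (t + 1) \<le> Q (t + 1)"
  proof (rule pos_variation_minimal)
    show "0 \<le> Q s" for s
      using pos_nonneg[of s] pos_nonneg[of t] L[of s] by (auto simp: Q_def j_def)
    show "max 0 (ext0 f b - ext0 f a) \<le> Q b - Q a" if ab: "a \<le> b" for a b
    proof (cases "a \<le> t \<and> t < b")
      case True
      then show ?thesis
        using cross[of b] L[of b] pos_increment[of a t] by (auto simp: Q_def j_def)
    next
      case False
      then show ?thesis using pos_increment[OF ab] ab by (auto simp: Q_def)
    qed
  qed
  then have "L = pos_variation f t" using L' by (simp add: Q_def j_def)
  then show ?thesis using lim by (simp add: continuous_within)
qed

lemma neg_right_cont: "continuous (at_right t) (neg_variation f)"
  using bv_path.pos_right_cont[OF bv_path_uminus] by (simp add: pos_variation_uminus)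

end

text \<open>Produces the paths of the zero, perturbed and averaged controls. \<open>A\<close> and
  \<open>B\<close> may be any increasing decomposition, because upper bounds on the minimal one
  suffice to bound the cost. \<open>A 0 \<ge> 0\<close> and \<open>B 0 \<ge> 0\<close> account for
  the jump from \<open>0-\<close>.\<close>

lemma difference_of_increasing:
  assumes A: "mono_on {0..} A" "A 0 \<ge> 0" "\<And>t. 0 \<le> t \<Longrightarrow> continuous (at_right t) A"
    and B: "mono_on {0..} B" "B 0 \<ge> 0" "\<And>t. 0 \<le> t \<Longrightarrow> continuous (at_right t) B"
    and f: "\<And>t. 0 \<le> t \<Longrightarrow> f t = A t - B t"
  shows "bv_path f"
    and "0 \<le> t \<Longrightarrow> pos_variation f t \<le> A t"
    and "0 \<le> t \<Longrightarrow> neg_variation f t \<le> B t"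
proof -
  have mono: "ext0 H a \<le> ext0 H b" "0 \<le> ext0 H a" if "mono_on {0..} H" "H 0 \<ge> 0" "a \<le> b"
    for H :: "real \<Rightarrow> real" and a b
    using that mono_onD[OF that(1), of 0 a] mono_onD[OF that(1), of 0 b] mono_onD[OF that(1), of a b]
    by (auto simp: ext0_def)
  have ext: "ext0 f s = ext0 A s - ext0 B s" for s using f by (simp add: ext0_def)
  have "pos_variation f t \<le> ext0 A t" for t
  proof (rule pos_variation_minimal)
    show "max 0 (ext0 f b - ext0 f a) \<le> ext0 A b - ext0 A a" if "a \<le> b" for a b
      using mono(1)[OF A(1,2) that] mono(1)[OF B(1,2) that] by (simp add: ext)
  qed (rule mono(2)[OF A(1,2) order_refl])
  then show "0 \<le> t \<Longrightarrow> pos_variation f t \<le> A t" by (metis ext0_def not_less)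
  have "neg_variation f t \<le> ext0 B t" for t unfolding neg_variation_eq
  proof (rule pos_variation_minimal)
    show "max 0 (ext0 (\<lambda>s. - f s) b - ext0 (\<lambda>s. - f s) a) \<le> ext0 B b - ext0 B a" if "a \<le> b" for a b
      using mono(1)[OF A(1,2) that] mono(1)[OF B(1,2) that] by (simp add: ext ext0_uminus)
  qed (rule mono(2)[OF B(1,2) order_refl])
  then show "0 \<le> t \<Longrightarrow> neg_variation f t \<le> B t" by (metis ext0_def not_less)
  \<comment> \<open>Monotone functions have left limits; restricting to nonnegative times does not
    change the left filter at a positive time.\<close>
  have left: "(H \<longlongrightarrow> Sup (H ` ({..<t} \<inter> {0..}))) (at_left t)"
    if "mono_on {0..} H" "0 < t" for H :: "real \<Rightarrow> real" and t
  proof -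
    have "(H \<longlongrightarrow> Sup (H ` ({..<t} \<inter> {0..}))) (at t within ({..<t} \<inter> {0..}))"
      by (rule Lim_left_bound[where K="H t"]) (use that in \<open>auto intro: mono_onD\<close>)
    moreover have "at t within ({..<t} \<inter> {0..}) = at_left t"
      by (rule at_within_nhd[where S="{0<..}"]) (use that in auto)
    ultimately show ?thesis by simp
  qed
  show "bv_path f"
  proof
    show "cadlag f" unfolding cadlag_def
    proof safe
      fix t :: real assume t: "0 \<le> t"
      have "((\<lambda>s. A s - B s) \<longlongrightarrow> f t) (at_right t)"
        using A(3)[OF t] B(3)[OF t] by (auto simp: continuous_within f[OF t] intro: tendsto_diff)
      moreover have "\<forall>\<^sub>F s in at_right t. A s - B s = f s"
        using t f by (intro eventually_at_right_less[THEN eventually_mono]) auto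
      ultimately show "continuous (at_right t) f"
        unfolding continuous_within by (rule Lim_transform_eventually)
    next
      fix t :: real assume t: "0 < t"
      have "((\<lambda>s. A s - B s) \<longlongrightarrow> Sup (A ` ({..<t} \<inter> {0..})) - Sup (B ` ({..<t} \<inter> {0..}))) (at_left t)"
        by (intro tendsto_diff left A(1) B(1) t)
      moreover have "\<forall>\<^sub>F s in at_left t. A s - B s = f s"
        using t f by (auto simp: eventually_at_left intro!: exI[of _ 0])
      ultimately show "\<exists>l. (f \<longlongrightarrow> l) (at_left t)"
        by (blast intro: Lim_transform_eventually)
    qed
    fix T :: real assume T: "0 \<le> T"
    have step: "\<bar>ext0 f b - ext0 f a\<bar> \<le> (ext0 A b + ext0 B b) - (ext0 A a + ext0 B a)" if "a \<le> b" for a b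
      using mono(1)[OF A(1,2) that] mono(1)[OF B(1,2) that] by (simp add: ext)
    show "bounded_variation_upto f T"
      unfolding bounded_variation_upto_def
    proof (rule bdd_aboveI[of _ "ext0 A T + ext0 B T"], clarify)
      fix n p assume np: "(n, p) \<in> partitions_upto T"
      have "(\<Sum>i<n. \<bar>ext0 f (p (Suc i)) - ext0 f (p i)\<bar>)
          \<le> (\<Sum>i<n. (ext0 A (p (Suc i)) + ext0 B (p (Suc i))) - (ext0 A (p i) + ext0 B (p i)))"
        by (intro sum_mono step) (use np in \<open>auto simp: partitions_upto_def\<close>)
      also have "\<dots> = (ext0 A (p n) + ext0 B (p n)) - (ext0 A (p 0) + ext0 B (p 0))"
        by (rule sum_lessThan_telescope)
      also have "\<dots> \<le> ext0 A T + ext0 B T"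
        using mono(1)[OF A(1,2) partitions_upto_le[OF np order_refl]]
          mono(1)[OF B(1,2) partitions_upto_le[OF np order_refl]]
          mono(2)[OF A(1,2) order_refl, of "p 0"] mono(2)[OF B(1,2) order_refl, of "p 0"]
        by linarith
      finally show "(\<Sum>i<n. \<bar>ext0 f (p (Suc i)) - ext0 f (p i)\<bar>) \<le> ext0 A T + ext0 B T" .
    qed
  qed
qed

section \<open>Measurability\<close>

lemma filterlim_at_right_sequentiallyI:
  fixes X :: "nat \<Rightarrow> real"
  assumes "X \<longlonglongrightarrow> x" "\<And>k. x < X k"
  shows "filterlim X (at_right x) sequentially"
  using assms(1) by (auto simp: filterlim_at assms(2) assms(2)[THEN less_imp_neq, THEN not_sym])

text \<open>Floor plus 1 instead of the ceiling keeps the grid point strictly to the right of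
  \<open>x\<close> even when \<open>x\<close> lies on the grid, as \<open>at_right\<close>
  requires.\<close>

lemma ceiling_grid_at_right:
  fixes x :: real
  shows "filterlim (\<lambda>k. (of_int \<lfloor>x * real (Suc k)\<rfloor> + 1) / real (Suc k)) (at_right x) sequentially"
proof -
  have gt: "x < (of_int \<lfloor>x * real (Suc k)\<rfloor> + 1) / real (Suc k)" for k
    using floor_correct[of "x * real (Suc k)"] by (simp add: field_simps)
  have le: "(of_int \<lfloor>x * real (Suc k)\<rfloor> + 1) / real (Suc k) \<le> x + 1 / real (Suc k)" for k
  proof -
    have "(of_int \<lfloor>x * real (Suc k)\<rfloor> + 1) / real (Suc k) \<le> (x * real (Suc k) + 1) / real (Suc k)"
      by (intro divide_right_mono add_right_mono of_int_floor_le) simp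
    then show ?thesis by (simp add: add_divide_distrib)
  qed
  have "(\<lambda>k. (of_int \<lfloor>x * real (Suc k)\<rfloor> + 1) / real (Suc k)) \<longlonglongrightarrow> x"
  proof (rule tendsto_sandwich[where f="\<lambda>_. x" and h="\<lambda>k. x + 1 / real (Suc k)"])
    show "(\<lambda>k. x + 1 / real (Suc k)) \<longlonglongrightarrow> x"
      using tendsto_add[OF tendsto_const LIMSEQ_inverse_real_of_nat, of x] by (simp add: inverse_eq_divide)
    show "(\<lambda>k. x) \<longlonglongrightarrow> x" by simp
  qed (use less_imp_le[OF gt] le in auto)
  then show ?thesis using gt by (rule filterlim_at_right_sequentiallyI)
qed

text \<open>Evaluating at the next grid point to the right gives a jointly measurable process, since
  its time index takes countably many values, and it converges by right continuity. Clamping by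
  \<open>max 0\<close> makes it a function on the whole time line.\<close>

lemma borel_measurable_right_continuous_process:
  fixes X :: "real \<Rightarrow> 'a \<Rightarrow> real"
  assumes meas: "\<And>t. 0 \<le> t \<Longrightarrow> X t \<in> borel_measurable M"
    and cont: "\<And>\<omega> t. \<omega> \<in> space M \<Longrightarrow> 0 \<le> t \<Longrightarrow> continuous (at_right t) (\<lambda>t. X t \<omega>)"
  shows "(\<lambda>(\<omega>, t). X (max 0 t) \<omega>) \<in> borel_measurable (M \<Otimes>\<^sub>M borel)"
proof (rule borel_measurable_LIMSEQ_metric)
  fix k
  define Y where "Y i = (\<lambda>p :: 'a \<times> real. X (max 0 ((of_int i + 1) / real (Suc k))) (fst p))" for i :: int
  have "(\<lambda>p. Y \<lfloor>max 0 (snd p) * real (Suc k)\<rfloor> p) \<in> borel_measurable (M \<Otimes>\<^sub>M borel)"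
  proof (rule measurable_compose_countable)
    show "Y i \<in> borel_measurable (M \<Otimes>\<^sub>M borel)" for i
      unfolding Y_def by (rule measurable_compose[OF measurable_fst meas]) simp
  qed measurable
  then show "(\<lambda>p. X (max 0 ((of_int \<lfloor>max 0 (snd p) * real (Suc k)\<rfloor> + 1) / real (Suc k))) (fst p))
      \<in> borel_measurable (M \<Otimes>\<^sub>M borel)"
    by (simp add: Y_def)
next
  fix p :: "'a \<times> real" assume p: "p \<in> space (M \<Otimes>\<^sub>M borel)"
  define s where "s = max 0 (snd p)"
  have "((\<lambda>t. X t (fst p)) \<longlongrightarrow> X s (fst p)) (at_right s)"
    using cont[of "fst p" s] p by (auto simp: s_def space_pair_measure continuous_within)
  from filterlim_compose[OF this ceiling_grid_at_right]
  have "(\<lambda>k. X ((of_int \<lfloor>s * real (Suc k)\<rfloor> + 1) / real (Suc k)) (fst p)) \<longlonglongrightarrow> X s (fst p)" .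
  moreover have "max 0 ((of_int \<lfloor>s * real (Suc k)\<rfloor> + 1) / real (Suc k)) =
      (of_int \<lfloor>s * real (Suc k)\<rfloor> + 1) / real (Suc k)" for k
    by (rule max_absorb2) (simp add: s_def)
  ultimately show "(\<lambda>k. X (max 0 ((of_int \<lfloor>max 0 (snd p) * real (Suc k)\<rfloor> + 1) / real (Suc k))) (fst p))
      \<longlonglongrightarrow> (case p of (\<omega>, t) \<Rightarrow> X (max 0 t) \<omega>)"
    by (simp add: s_def split_beta)
qed

section \<open>The positive variation as a countable supremum\<close>

lemma grid_partition:
  assumes "sorted (zs :: int list)"
  shows "(length zs - 1, \<lambda>i. min t (of_int (zs ! i) / real (Suc k))) \<in> partitions_upto t"
  unfolding partitions_upto_def
proof (clarify, intro conjI allI impI min.mono divide_right_mono min.cobounded1 order_refl)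
  show "real_of_int (zs ! i) \<le> of_int (zs ! Suc i)" if "i < length zs - 1" for i
    using sorted_nth_mono[OF assms, of i "Suc i"] that by simp
qed simp

context bv_path
begin

text \<open>Moving the partition points to the right onto a grid changes the sums by an amount that
  tends to 0, by right continuity; grid partitions are countably many. The cap at \<open>t\<close>
  keeps the formula within the information available at time \<open>t\<close>. The empty list stands
  for zero subintervals, as \<open>0 - 1 = 0\<close> for natural numbers.\<close>

lemma pos_variation_countable:
  "pos_variation f t = (SUP (k, zs) \<in> (UNIV :: nat set) \<times> {zs :: int list. sorted zs}.
     \<Sum>i<length zs - 1. max 0 (ext0 f (min t (of_int (zs ! Suc i) / real (Suc k)))
       - ext0 f (min t (of_int (zs ! i) / real (Suc k)))))" (is "_ = (SUP (k, zs) \<in> ?J. ?S k zs)")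
proof (rule antisym)
  have le: "?S k zs \<le> pos_variation f t" if "sorted zs" for k zs
    using pos_sum_le_pos_variation[OF bv_all grid_partition[OF that]] by simp
  show "(SUP (k, zs) \<in> ?J. ?S k zs) \<le> pos_variation f t"
    by (rule cSUP_least) (use le in \<open>auto intro: exI[of _ "[]"]\<close>)
  have bdd: "bdd_above ((\<lambda>(k, zs). ?S k zs) ` ?J)"
    by (rule bdd_aboveI[of _ "pos_variation f t"]) (use le in auto)
  show "pos_variation f t \<le> (SUP (k, zs) \<in> ?J. ?S k zs)"
  proof (rule pos_variation_least)
    fix n p assume np: "(n, p) \<in> partitions_upto t"
    define zs where "zs k = map (\<lambda>i. \<lfloor>p i * real (Suc k)\<rfloor> + 1) [0..<Suc n]" for k
    have p_mono: "p i \<le> p j" if "i \<le> j" "j \<le> n" for i j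
      using that
    proof (induction rule: inc_induct)
      case (step m)
      then have "p m \<le> p (Suc m)" using np by (simp add: partitions_upto_def)
      then show ?case using step by linarith
    qed simp
    have sorted: "sorted (zs k)" for k
      unfolding sorted_iff_nth_mono zs_def
      by (auto simp del: upt_Suc intro!: floor_mono mult_right_mono p_mono)
    have conv: "(\<lambda>k. ext0 f (min t (of_int (zs k ! i) / real (Suc k)))) \<longlonglongrightarrow> ext0 f (p i)" if i: "i \<le> n" for i
    proof -
      have zs: "of_int (zs k ! i) = (of_int \<lfloor>p i * real (Suc k)\<rfloor> + 1 :: real)" for k
        using i by (simp add: zs_def del: upt_Suc)
      note lim = ceiling_grid_at_right[of "p i"]
      have gt: "p i < (of_int \<lfloor>p i * real (Suc k)\<rfloor> + 1) / real (Suc k)" for k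
        using floor_correct[of "p i * real (Suc k)"] by (simp add: field_simps)
      show ?thesis
      \<comment> \<open>At the end point the grid overshoots and the cap returns exactly
        \<open>t\<close>; below it the capped points still lie strictly to the right of
        \<open>p i\<close>.\<close>
      proof (cases "p i = t")
        case True
        then have "min t (of_int (zs k ! i) / real (Suc k)) = p i" for k
          using gt[of k] unfolding zs by simp
        then show ?thesis by simp
      next
        case False
        then have "p i < t" using partitions_upto_le[OF np i] by simp
        have gt_min: "p i < min t (of_int (zs k ! i) / real (Suc k))" for k
          using \<open>p i < t\<close> gt[of k] unfolding zs by simp
        have "(\<lambda>k. min t (of_int (zs k ! i) / real (Suc k))) \<longlonglongrightarrow> min t (p i)"
          unfolding zs using lim by (intro tendsto_min tendsto_const) (simp add: filterlim_at)
        then have "filterlim (\<lambda>k. min t (of_int (zs k ! i) / real (Suc k))) (at_right (p i)) sequentially"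
          using gt_min \<open>p i < t\<close> by (intro filterlim_at_right_sequentiallyI) auto
        from filterlim_compose[OF ext0_right_cont this] show ?thesis .
      qed
    qed
    show "(\<Sum>i<n. max 0 (ext0 f (p (Suc i)) - ext0 f (p i))) \<le> (SUP (k, zs) \<in> ?J. ?S k zs)"
    proof (rule LIMSEQ_le_const2)
      show "(\<lambda>k. ?S k (zs k)) \<longlonglongrightarrow> (\<Sum>i<n. max 0 (ext0 f (p (Suc i)) - ext0 f (p i)))"
      proof -
        have [simp]: "length (zs k) - 1 = n" for k by (simp add: zs_def)
        show ?thesis
          unfolding \<open>\<And>k. length (zs k) - 1 = n\<close>
          by (intro tendsto_sum tendsto_max tendsto_diff tendsto_const conv) auto
      qed
      show "\<exists>N. \<forall>k\<ge>N. ?S k (zs k) \<le> (SUP (k, zs) \<in> ?J. ?S k zs)"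
      proof (intro exI allI impI)
        fix k
        show "?S k (zs k) \<le> (SUP (k, zs) \<in> ?J. ?S k zs)"
          using cSUP_upper[OF _ bdd, of "(k, zs k)"] sorted by simp
      qed
    qed
  qed
qed

end

text \<open>Only times up to \<open>t\<close> enter, so with \<open>N\<close> the \<sigma>-algebra
  at time \<open>t\<close> this yields adaptedness of the variation.\<close>

lemma borel_measurable_pos_variation:
  assumes meas: "\<And>s. 0 \<le> s \<Longrightarrow> s \<le> t \<Longrightarrow> I s \<in> borel_measurable N"
    and bv: "\<And>\<omega>. \<omega> \<in> space N \<Longrightarrow> bv_path (\<lambda>t. I t \<omega>)"
  shows "(\<lambda>\<omega>. pos_variation (\<lambda>t. I t \<omega>) t) \<in> borel_measurable N"
proof -
  let ?J = "(UNIV :: nat set) \<times> {zs :: int list. sorted zs}"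
  let ?S = "\<lambda>(k, zs) \<omega>. \<Sum>i<length zs - 1. max 0 (ext0 (\<lambda>t. I t \<omega>) (min t (of_int (zs ! Suc i) / real (Suc k)))
       - ext0 (\<lambda>t. I t \<omega>) (min t (of_int (zs ! i) / real (Suc k))))"
  have ext [measurable]: "(\<lambda>\<omega>. ext0 (\<lambda>t. I t \<omega>) (min t s)) \<in> borel_measurable N" for s
    using meas[of "min t s"] by (cases "min t s < 0") (auto simp: ext0_def)
  have "(\<lambda>\<omega>. SUP i\<in>?J. ?S i \<omega>) \<in> borel_measurable N"
  proof (rule borel_measurable_cSUP)
    show "?S i \<in> borel_measurable N" for i
      by (cases i) simp
    fix \<omega> assume "\<omega> \<in> space N"
    then interpret bv_path "\<lambda>t. I t \<omega>" by (rule bv)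
    show "bdd_above ((\<lambda>i. ?S i \<omega>) ` ?J)"
    proof (rule bdd_aboveI[of _ "pos_variation (\<lambda>t. I t \<omega>) t"])
      fix y assume "y \<in> (\<lambda>i. ?S i \<omega>) ` ?J"
      then obtain k and zs :: "int list" where "sorted zs" and y: "y = ?S (k, zs) \<omega>" by auto
      from pos_sum_le_pos_variation[OF bv_all grid_partition[OF this(1)]]
      show "y \<le> pos_variation (\<lambda>t. I t \<omega>) t" unfolding y by simp
    qed
  qed auto
  then show ?thesis
    by (subst measurable_cong) (auto simp: bv_path.pos_variation_countable[OF bv] split_beta)
qed

section \<open>First positive times are stopping times\<close>

lemma first_positive_time_less_iff:
  "first_positive_time f < u \<longleftrightarrow> (\<exists>t\<ge>0. ennreal t < u \<and> f t > 0)"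
  by (auto simp: first_positive_time_def Inf_less_iff)

text \<open>By monotonicity a positive value persists, so the events with strict inequality reduce
  to rational times. Right continuity of the filtration then passes from \<open><\<close> to
  \<open>\<le>\<close>.\<close>

lemma stopping_time_first_positive_time:
  fixes V :: "real \<Rightarrow> 'a \<Rightarrow> real" and F :: "ennreal \<Rightarrow> 'a measure"
  assumes "filtration \<Omega> F"
    and rc: "\<And>t. t < \<infinity> \<Longrightarrow> sets (F t) = (\<Inter>u\<in>{t<..}. sets (F u))"
    and V: "\<And>t. 0 \<le> t \<Longrightarrow> V t \<in> borel_measurable (F (ennreal t))"
    and mono: "\<And>\<omega>. \<omega> \<in> \<Omega> \<Longrightarrow> mono (\<lambda>t. V t \<omega>)"
  shows "stopping_time F (\<lambda>\<omega>. first_positive_time (\<lambda>t. V t \<omega>))"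
proof
  interpret filtration \<Omega> F by fact
  let ?T = "\<lambda>\<omega>. first_positive_time (\<lambda>t. V t \<omega>)"
  have less: "{\<omega>\<in>\<Omega>. ?T \<omega> < ennreal r} \<in> sets (F (ennreal r))" for r
  proof -
    have "{\<omega>\<in>\<Omega>. ?T \<omega> < ennreal r} = (\<Union>q\<in>{q. 0 \<le> q \<and> q < r} \<inter> \<rat>. {\<omega>\<in>space (F (ennreal q)). V q \<omega> > 0})"
    proof (intro set_eqI iffI)
      fix \<omega> assume "\<omega> \<in> {\<omega>\<in>\<Omega>. ?T \<omega> < ennreal r}"
      then obtain t where t: "\<omega> \<in> \<Omega>" "0 \<le> t" "ennreal t < ennreal r" "V t \<omega> > 0"
        by (auto simp: first_positive_time_less_iff)
      then have "t < r" by (simp add: ennreal_less_iff)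
      then obtain q where q: "q \<in> \<rat>" "t < q" "q < r" using Rats_dense_in_real by blast
      with t monoD[OF mono[OF t(1)], of t q]
      show "\<omega> \<in> (\<Union>q\<in>{q. 0 \<le> q \<and> q < r} \<inter> \<rat>. {\<omega>\<in>space (F (ennreal q)). V q \<omega> > 0})"
        by (auto simp: space_F intro!: bexI[of _ q])
    next
      fix \<omega> assume "\<omega> \<in> (\<Union>q\<in>{q. 0 \<le> q \<and> q < r} \<inter> \<rat>. {\<omega>\<in>space (F (ennreal q)). V q \<omega> > 0})"
      then show "\<omega> \<in> {\<omega>\<in>\<Omega>. ?T \<omega> < ennreal r}"
        by (auto simp: space_F first_positive_time_less_iff ennreal_less_iff)
    qed
    also have "\<dots> \<in> sets (F (ennreal r))"
    proof (rule sets.countable_UN'')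
      show "countable ({q. 0 \<le> q \<and> q < r} \<inter> \<rat>)" using countable_rat by (rule countable_subset[rotated]) auto
      show "{\<omega>\<in>space (F (ennreal q)). V q \<omega> > 0} \<in> sets (F (ennreal r))"
        if "q \<in> {q. 0 \<le> q \<and> q < r} \<inter> \<rat>" for q
      proof -
        have [measurable]: "V q \<in> borel_measurable (F (ennreal q))" using that V by auto
        have "{\<omega>\<in>space (F (ennreal q)). V q \<omega> > 0} \<in> sets (F (ennreal q))" by measurable
        then show ?thesis using sets_F_mono[of "ennreal q" "ennreal r"] that by (auto intro: ennreal_leI)
      qed
    qed
    finally show ?thesis .
  qed
  fix t
  show "Measurable.pred (F t) (\<lambda>\<omega>. ?T \<omega> \<le> t)"
  proof (cases t)
    case top then show ?thesis by simp
  next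
    case (real s)
    \<comment> \<open>Membership at time \<open>t\<close> is checked at every later
      \<open>u\<close>: the approximating times decrease to \<open>s\<close> and start no later than
      \<open>r\<close>, which lies below \<open>u\<close>.\<close>
    have "{\<omega>\<in>\<Omega>. ?T \<omega> \<le> t} \<in> sets (F u)" if "t < u" for u
    proof -
      obtain r where r: "t < ennreal r" "ennreal r < u" 
        using ennreal_rat_dense[OF \<open>t < u\<close>] by auto
      then have sr: "s < r" using real by (simp add: ennreal_less_iff)
      have eq: "{\<omega>\<in>\<Omega>. ?T \<omega> \<le> t} = (\<Inter>n. {\<omega>\<in>\<Omega>. ?T \<omega> < ennreal (s + (r - s) / real (Suc n))})"
      proof (intro set_eqI iffI)
        fix \<omega> assume "\<omega> \<in> {\<omega>\<in>\<Omega>. ?T \<omega> \<le> t}"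
        moreover have "t < ennreal (s + (r - s) / real (Suc n))" for n
          using real sr by (simp add: ennreal_less_iff)
        ultimately show "\<omega> \<in> (\<Inter>n. {\<omega>\<in>\<Omega>. ?T \<omega> < ennreal (s + (r - s) / real (Suc n))})"
          by (auto intro: le_less_trans)
      next
        fix \<omega> assume *: "\<omega> \<in> (\<Inter>n. {\<omega>\<in>\<Omega>. ?T \<omega> < ennreal (s + (r - s) / real (Suc n))})"
        have "?T \<omega> \<le> ennreal (s + (r - s) * 0)"
        proof (rule LIMSEQ_le_const)
          show "(\<lambda>n. ennreal (s + (r - s) * inverse (real (Suc n)))) \<longlonglongrightarrow> ennreal (s + (r - s) * 0)"
            by (intro tendsto_ennrealI tendsto_intros LIMSEQ_inverse_real_of_nat)
          show "\<exists>N. \<forall>n\<ge>N. ?T \<omega> \<le> ennreal (s + (r - s) * inverse (real (Suc n)))"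
            using * by (auto simp: divide_inverse intro: less_imp_le)
        qed
        then show "\<omega> \<in> {\<omega>\<in>\<Omega>. ?T \<omega> \<le> t}" using * real by auto
      qed
      have "{\<omega>\<in>\<Omega>. ?T \<omega> < ennreal (s + (r - s) / real (Suc n))} \<in> sets (F u)" for n
      proof -
        have "s + (r - s) / real (Suc n) \<le> s + (r - s) / 1"
          using sr by (intro add_left_mono divide_left_mono) auto
        then have "ennreal (s + (r - s) / real (Suc n)) \<le> u"
          using r by (metis add.commute diff_add_cancel div_by_1 ennreal_leI le_less_trans less_imp_le)
        then show ?thesis using less sets_F_mono by blast
      qed
      then show ?thesis unfolding eq by (intro sets.countable_INT) auto
    qed
    then have "{\<omega>\<in>\<Omega>. ?T \<omega> \<le> t} \<in> sets (F t)"
      using rc[of t] real by auto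
    then show ?thesis by (simp add: pred_def space_F)
  qed
qed

section \<open>Discounted Lebesgue measure\<close>

text \<open>For \<rho> > 0 the total mass is 1/\<rho> and not 1: a payment \<open>q\<close> at time
  \<open>s\<close> is therefore spread as the rate \<open>\<rho> * q\<close> over
  \<open>{s..}\<close>.\<close>

definition disc_lborel :: "real \<Rightarrow> real measure" where
  "disc_lborel \<rho> = density lborel (\<lambda>t. ennreal (indicator {0..} t * exp (- \<rho> * t)))"

lemma sets_disc_lborel [measurable_cong, simp]: "sets (disc_lborel \<rho>) = sets borel"
  by (simp add: disc_lborel_def)

lemma space_disc_lborel [simp]: "space (disc_lborel \<rho>) = UNIV"
  by (simp add: disc_lborel_def)

lemma nn_integral_disc_lborel:
  assumes [measurable]: "f \<in> borel_measurable borel"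
  shows "(\<integral>\<^sup>+t. f t \<partial>disc_lborel \<rho>) = (\<integral>\<^sup>+t\<in>{0..}. ennreal (exp (- \<rho> * t)) * f t \<partial>lborel)"
  unfolding disc_lborel_def
  by (subst nn_integral_density) (auto intro!: nn_integral_cong simp: indicator_def)

lemma integral_disc_lborel:
  fixes f :: "real \<Rightarrow> real"
  assumes [measurable]: "f \<in> borel_measurable borel"
  shows "(LINT t|disc_lborel \<rho>. f t) = (LINT t:{0..}|lborel. exp (- \<rho> * t) * f t)"
  unfolding disc_lborel_def set_lebesgue_integral_def
  by (subst integral_density) (auto intro!: Bochner_Integration.integral_cong simp: indicator_def)

lemma emeasure_disc_lborel_atLeast:
  assumes "0 < \<rho>" "0 \<le> s"
  shows "emeasure (disc_lborel \<rho>) {s..} = ennreal (exp (- \<rho> * s) / \<rho>)"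
proof -
  have "emeasure (disc_lborel \<rho>) {s..} = (\<integral>\<^sup>+t. ennreal (exp (- \<rho> * t)) * indicator {s..} t \<partial>lborel)"
    unfolding disc_lborel_def
    by (subst emeasure_density) (use assms in \<open>auto intro!: nn_integral_cong simp: indicator_def\<close>)
  also have "\<dots> = ennreal (0 - (- exp (- \<rho> * s) / \<rho>))"
  proof (rule nn_integral_FTC_atLeast)
    show "DERIV (\<lambda>t. - exp (- \<rho> * t) / \<rho>) x :> exp (- \<rho> * x)" for x
      using assms by (auto intro!: derivative_eq_intros)
    have "((\<lambda>t. exp (- \<rho> * t)) \<longlongrightarrow> 0) at_top"
      using assms by (auto simp: filterlim_uminus_at_bot intro!: filterlim_compose[OF exp_at_bot]
          filterlim_tendsto_pos_mult_at_top[OF tendsto_const] filterlim_ident)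
    from tendsto_divide[OF tendsto_minus[OF this] tendsto_const, of \<rho>]
    show "((\<lambda>t. - exp (- \<rho> * t) / \<rho>) \<longlongrightarrow> 0) at_top" using assms by simp
  qed auto
  finally show ?thesis by simp
qed

lemma finite_measure_disc_lborel: "0 < \<rho> \<Longrightarrow> finite_measure (disc_lborel \<rho>)"
proof
  assume \<rho>: "0 < \<rho>"
  have "emeasure (disc_lborel \<rho>) (space (disc_lborel \<rho>)) = emeasure (disc_lborel \<rho>) {0..}"
    unfolding disc_lborel_def
    by (subst (1 2) emeasure_density) (auto intro!: nn_integral_cong simp: indicator_def)
  then show "emeasure (disc_lborel \<rho>) (space (disc_lborel \<rho>)) \<noteq> \<infinity>"
    using emeasure_disc_lborel_atLeast[OF \<rho>, of 0] by simp
qed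

lemma AE_disc_lborel_nonneg: "AE t in disc_lborel \<rho>. 0 \<le> t"
  unfolding disc_lborel_def by (subst AE_density) (auto simp: indicator_def)

lemma AE_disc_lborel_neq: "AE t in disc_lborel \<rho>. t \<noteq> x"
  unfolding disc_lborel_def by (subst AE_density) (use AE_lborel_singleton[of x] in auto)

text \<open>Integration by parts, in the form of Tonelli's theorem on \<open>{(s, t). 0 \<le> s \<le> t}\<close>.\<close>

lemma nn_integral_exp_interval_measure:
  fixes V :: "real \<Rightarrow> real"
  assumes \<rho>: "0 < \<rho>" and mono: "mono V" and rc: "\<And>t. continuous (at_right t) V"
    and neg: "\<And>t. t < 0 \<Longrightarrow> V t = 0"
  shows "(\<integral>\<^sup>+t\<in>{0..}. ennreal (exp (- \<rho> * t)) \<partial>interval_measure V) =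
    (\<integral>\<^sup>+t. ennreal (\<rho> * V t) \<partial>disc_lborel \<rho>)"
proof -
  let ?V = "interval_measure V"
  interpret V: sigma_finite_measure ?V
    by (rule sigma_finite_interval_measure) (auto intro: monoD[OF mono] rc)
  interpret L: finite_measure "disc_lborel \<rho>" using \<rho> by (rule finite_measure_disc_lborel)
  interpret pair_sigma_finite ?V "disc_lborel \<rho>" ..
  have Ioc: "emeasure ?V {a<..b} = ennreal (V b - V a)" if "a \<le> b" for a b
    by (rule emeasure_interval_measure_Ioc[OF that]) (auto intro: monoD[OF mono] rc)
  \<comment> \<open>The interval measure is known on half-open intervals. The part
    \<open>{-1<..<0}\<close> is null because \<open>V\<close> vanishes there, so
    \<open>{0..t}\<close> has the mass of \<open>{-1<..t}\<close>, including the atom at 0.\<close>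
  have "emeasure ?V (\<Union>n. {-1<..- 1 / real (Suc n)}) = 0"
  proof (subst emeasure_UN_eq_0)
    show "emeasure ?V {-1<..- 1 / real (Suc n)} = 0" for n
      by (subst Ioc) (auto simp: neg)
  qed auto
  also have "(\<Union>n. {-1<..- 1 / real (Suc n)}) = {-1<..<0}"
  proof (intro set_eqI iffI)
    fix x :: real assume x: "x \<in> {-1<..<0}"
    then obtain n where "inverse (real (Suc n)) < - x" using reals_Archimedean[of "-x"] by auto
    then show "x \<in> (\<Union>n. {-1<..- 1 / real (Suc n)})"
      using x by (auto simp: divide_inverse intro!: exI[of _ n])
  qed (auto simp: divide_neg_pos elim: le_less_trans)
  finally have null: "{-1<..<0} \<in> null_sets ?V" by (simp add: null_sets_def)
  have Icc: "emeasure ?V {0..t} = ennreal (V t)" if "0 \<le> t" for t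
  proof -
    have "emeasure ?V {0..t} = emeasure ?V ({0..t} \<union> {-1<..<0})"
      using null by (simp add: emeasure_Un_null_set)
    also have "{0..t} \<union> {-1<..<0} = {-1<..t}" using that by auto
    also have "emeasure ?V \<dots> = ennreal (V t)" using that by (subst Ioc) (auto simp: neg)
    finally show ?thesis .
  qed
  \<comment> \<open>The discount factor at \<open>s\<close> is \<rho> times the mass of
    \<open>{s..}\<close>; exchanging the integrals then leaves \<rho> times the mass of
    \<open>{0..t}\<close>.\<close>
  have "(\<integral>\<^sup>+t\<in>{0..}. ennreal (exp (- \<rho> * t)) \<partial>?V) =
      (\<integral>\<^sup>+s. (\<integral>\<^sup>+t. ennreal \<rho> * indicator {0..} s * indicator {s..} t \<partial>disc_lborel \<rho>) \<partial>?V)"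
  proof (intro nn_integral_cong)
    fix s
    show "ennreal (exp (- \<rho> * s)) * indicator {0..} s =
       (\<integral>\<^sup>+t. ennreal \<rho> * indicator {0..} s * indicator {s..} t \<partial>disc_lborel \<rho>)"
      using \<rho> by (subst nn_integral_cmult)
        (auto simp: indicator_def[of "{0..}"] emeasure_disc_lborel_atLeast ennreal_mult'[symmetric])
  qed
  also have "\<dots> = (\<integral>\<^sup>+t. (\<integral>\<^sup>+s. ennreal \<rho> * indicator {0..} s * indicator {s..} t \<partial>?V) \<partial>disc_lborel \<rho>)"
  proof (rule Fubini'[symmetric])
    have "(\<lambda>x. ennreal \<rho> * indicator {0..} (fst x) * indicator {p. fst p \<le> snd p} x)
      \<in> borel_measurable (?V \<Otimes>\<^sub>M disc_lborel \<rho> :: (real \<times> real) measure)" by measurable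
    then show "(\<lambda>(s, t). ennreal \<rho> * indicator {0..} s * indicator {s..} t)
      \<in> borel_measurable (?V \<Otimes>\<^sub>M disc_lborel \<rho>)"
      by (rule measurable_cong[THEN iffD1, rotated]) (auto simp: indicator_def)
  qed
  also have "\<dots> = (\<integral>\<^sup>+t. ennreal (\<rho> * V t) \<partial>disc_lborel \<rho>)"
  proof (intro nn_integral_cong)
    fix t :: real
    have "(\<integral>\<^sup>+s. ennreal \<rho> * indicator {0..} s * indicator {s..} t \<partial>?V) =
        (\<integral>\<^sup>+s. ennreal \<rho> * indicator {0..t} s \<partial>?V)"
      by (intro nn_integral_cong) (auto simp: indicator_def)
    also have "\<dots> = ennreal \<rho> * emeasure ?V {0..t}" by (subst nn_integral_cmult) auto
    also have "\<dots> = ennreal (\<rho> * V t)"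
      using \<rho> by (cases "0 \<le> t") (auto simp: Icc neg ennreal_mult')
    finally show "(\<integral>\<^sup>+s. ennreal \<rho> * indicator {0..} s * indicator {s..} t \<partial>?V) = ennreal (\<rho> * V t)" .
  qed
  finally show ?thesis .
qed

section \<open>Control problem and game for a fixed demand process\<close>

text \<open>Extend \<open>h\<close> by 0 off the open strip; the extension is Borel and agrees with
  \<open>h\<close> along \<open>x\<close>, which stays in \<open>U\<close>.\<close>

lemma borel_measurable_continuous_on_strip:
  fixes h :: "real \<Rightarrow> real \<Rightarrow> real"
  assumes "open U" and h: "continuous_on (UNIV \<times> U) (\<lambda>(c, d). h c d)"
    and [measurable]: "a \<in> borel_measurable N" "x \<in> borel_measurable N"
    and x: "\<And>p. p \<in> space N \<Longrightarrow> x p \<in> U"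
  shows "(\<lambda>p. h (a p) (x p)) \<in> borel_measurable N"
proof -
  have "open (UNIV \<times> U :: (real \<times> real) set)" using assms(1) by (intro open_Times) auto
  then have "(\<lambda>p. indicator (UNIV \<times> U) p *\<^sub>R (case p of (c, d) \<Rightarrow> h c d)) \<in> borel_measurable borel"
    by (intro borel_measurable_continuous_on_indicator h) simp
  then have "(\<lambda>p. indicator (UNIV \<times> U) (a p, x p) *\<^sub>R (case (a p, x p) of (c, d) \<Rightarrow> h c d)) \<in> borel_measurable N"
    by (rule measurable_compose[rotated]) measurable
  then show ?thesis
    by (rule measurable_cong[THEN iffD1, rotated]) (use x in \<open>auto simp: indicator_def\<close>)
qed

text \<open>Spreads a lump sum paid at \<open>a\<close> over the time after \<open>a\<close>, so
  that the rewards of the game become integrals against the same measure as the costs. For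
  \<open>a = \<infinity>\<close> both sides are 0.\<close>

lemma integral_disc_lborel_stop:
  assumes "0 < \<rho>"
  shows "integrable (disc_lborel \<rho>) (\<lambda>t. if a \<le> ennreal (max 0 t) then k else 0 :: real)"
    and "(LINT t|disc_lborel \<rho>. (if a \<le> ennreal (max 0 t) then k else 0)) = k * discount \<rho> a / \<rho>"
proof -
  interpret finite_measure "disc_lborel \<rho>" using assms by (rule finite_measure_disc_lborel)
  have "Measurable.pred (disc_lborel \<rho>) (\<lambda>t. a \<le> ennreal (max 0 t))" by measurable
  then show "integrable (disc_lborel \<rho>) (\<lambda>t. if a \<le> ennreal (max 0 t) then k else 0 :: real)"
    by (intro integrable_const_bound[where B="\<bar>k\<bar>"]) auto
  show "(LINT t|disc_lborel \<rho>. (if a \<le> ennreal (max 0 t) then k else 0)) = k * discount \<rho> a / \<rho>"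
  proof (cases a)
    case top
    then show ?thesis by (simp add: discount_def top_unique)
  next
    case (real s)
    have "(LINT t|disc_lborel \<rho>. (if a \<le> ennreal (max 0 t) then k else 0)) =
        (LINT t|disc_lborel \<rho>. k * indicator {s..} t)"
    proof (rule integral_cong_AE)
      show "AE t in disc_lborel \<rho>. (if a \<le> ennreal (max 0 t) then k else 0) = k * indicator {s..} t"
        using AE_disc_lborel_nonneg[of \<rho>] by eventually_elim (use real in auto)
    qed measurable
    also have "\<dots> = k * measure (disc_lborel \<rho>) {s..}" by simp
    also have "\<dots> = k * discount \<rho> a / \<rho>"
      using real assms by (simp add: measure_def emeasure_disc_lborel_atLeast discount_def)
    finally show ?thesis .
  qed
qed

text \<open>The problem for one demand process. The assumptions are preserved under reflection of
  \<open>c\<close> with \<open>qp\<close> and \<open>qm\<close> exchanged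
  (\<open>reflected\<close>), so one perturbation argument serves both one-sided estimates.\<close>

locale control_problem = prob_space M + filtration "space M" F
  for M :: "'a measure" and F :: "ennreal \<Rightarrow> 'a measure" +
  fixes X :: "real \<Rightarrow> 'a \<Rightarrow> real" and U :: "real set" and g gc :: "real \<Rightarrow> real \<Rightarrow> real"
    and \<rho> qp qm :: real
  assumes F_sub: "\<And>t. sets (F t) \<subseteq> sets M"
    and F_right: "\<And>t. t < \<infinity> \<Longrightarrow> sets (F t) = (\<Inter>u\<in>{t<..}. sets (F u))"
    and X_adapted: "adapted F X"
    and X_cont: "\<And>\<omega>. \<omega> \<in> space M \<Longrightarrow> continuous_on {0..} (\<lambda>t. X t \<omega>)"
    and X_in: "\<And>\<omega> t. \<omega> \<in> space M \<Longrightarrow> 0 \<le> t \<Longrightarrow> X t \<omega> \<in> U"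
    and open_U: "open U"
    and g_nonneg: "\<And>c d. d \<in> U \<Longrightarrow> 0 \<le> g c d"
    and g_cont: "continuous_on (UNIV \<times> U) (\<lambda>(c, d). g c d)"
    and g_convex: "\<And>d. d \<in> U \<Longrightarrow> convex_on UNIV (\<lambda>c. g c d)"
    and g_deriv: "\<And>c d. d \<in> U \<Longrightarrow> ((\<lambda>x. g x d) has_real_derivative gc c d) (at c)"
    and gc_cont: "continuous_on (UNIV \<times> U) (\<lambda>(c, d). gc c d)"
    and g_integrable: "\<And>c. integrable (M \<Otimes>\<^sub>M disc_lborel \<rho>) (\<lambda>(\<omega>, t). g c (X (max 0 t) \<omega>))"
    and gc_integrable: "\<And>c. integrable (M \<Otimes>\<^sub>M disc_lborel \<rho>) (\<lambda>(\<omega>, t). gc c (X (max 0 t) \<omega>))"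
    and \<rho>_pos: "0 < \<rho>" and qp_pos: "0 < qp" and qm_pos: "0 < qm"
begin

abbreviation Q :: "('a \<times> real) measure" where
  "Q \<equiv> M \<Otimes>\<^sub>M disc_lborel \<rho>"

abbreviation cost :: "real \<Rightarrow> (real \<Rightarrow> 'a \<Rightarrow> real) \<Rightarrow> ennreal" where
  "cost \<equiv> total_cost M \<rho> qp qm g X"

abbreviation payoff :: "real \<Rightarrow> ('a \<Rightarrow> ennreal) \<Rightarrow> ('a \<Rightarrow> ennreal) \<Rightarrow> real" where
  "payoff \<equiv> dynkin_payoff M \<rho> qp qm gc X"

definition val :: "real \<Rightarrow> ennreal" where
  "val c = (INF I\<in>controls M F. cost c I)"

sublocale L: finite_measure "disc_lborel \<rho>"
  by (rule finite_measure_disc_lborel[OF \<rho>_pos])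

sublocale MxL: pair_sigma_finite M "disc_lborel \<rho>" ..

sublocale Q: finite_measure Q
  by (rule finite_measure_pair_measure) unfold_locales

lemma measurable_F_M: "h \<in> borel_measurable (F t) \<Longrightarrow> h \<in> borel_measurable M"
  by (rule measurable_mono[THEN subsetD, OF order_refl refl F_sub space_F])

lemma tangent: "d \<in> U \<Longrightarrow> gc x d * (y - x) \<le> g y d - g x d"
  using convex_on_imp_above_tangent[OF g_convex, of d x y "gc x d"] g_deriv[of d x] by simp

lemma gc_mono: "d \<in> U \<Longrightarrow> x \<le> y \<Longrightarrow> gc x d \<le> gc y d"
proof (cases "x = y")
  case False
  assume d: "d \<in> U" and "x \<le> y"
  then have "0 < y - x" using False by simp
  moreover have "gc x d * (y - x) \<le> gc y d * (y - x)"
    using tangent[OF d, of x y] tangent[OF d, of y x] by (simp add: algebra_simps)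
  ultimately show ?thesis by (simp add: mult_le_cancel_right)
qed simp

lemma measurable_X [measurable]: "(\<lambda>p. X (max 0 (snd p)) (fst p)) \<in> borel_measurable (M \<Otimes>\<^sub>M borel)"
proof -
  have "(\<lambda>(\<omega>, t). X (max 0 t) \<omega>) \<in> borel_measurable (M \<Otimes>\<^sub>M borel)"
  proof (rule borel_measurable_right_continuous_process)
    show "X t \<in> borel_measurable M" if "0 \<le> t" for t
      using X_adapted that by (auto simp: adapted_def intro: measurable_F_M)
    show "continuous (at_right t) (\<lambda>t. X t \<omega>)" if "\<omega> \<in> space M" "0 \<le> t" for \<omega> t
      using X_cont[OF that(1)] that(2)
      by (auto simp: continuous_on_eq_continuous_within intro: continuous_within_subset)
  qed
  then show ?thesis by (simp add: split_beta')
qed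

lemma X_in': "p \<in> space (M \<Otimes>\<^sub>M borel) \<Longrightarrow> X (max 0 (snd p)) (fst p) \<in> U"
  by (auto simp: space_pair_measure intro: X_in)

lemma measurable_g_X:
  "a \<in> borel_measurable (M \<Otimes>\<^sub>M borel) \<Longrightarrow>
    (\<lambda>p. g (a p) (X (max 0 (snd p)) (fst p))) \<in> borel_measurable (M \<Otimes>\<^sub>M borel)"
  by (rule borel_measurable_continuous_on_strip[OF open_U g_cont _ measurable_X]) (auto intro: X_in')

lemma measurable_gc_X:
  "(\<lambda>p. gc c (X (max 0 (snd p)) (fst p))) \<in> borel_measurable (M \<Otimes>\<^sub>M borel)"
  by (rule borel_measurable_continuous_on_strip[OF open_U gc_cont _ measurable_X]) (auto intro: X_in')

lemma controls_bv: "I \<in> controls M F \<Longrightarrow> \<omega> \<in> space M \<Longrightarrow> bv_path (\<lambda>t. I t \<omega>)"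
  by (auto simp: controls_def bv_path_def)

lemma controlsI:
  assumes "\<And>t. 0 \<le> t \<Longrightarrow> I t \<in> borel_measurable (F (ennreal t))"
    and "\<And>\<omega>. \<omega> \<in> space M \<Longrightarrow> bv_path (\<lambda>t. I t \<omega>)"
  shows "I \<in> controls M F"
  using assms by (auto simp: controls_def bv_path_def adapted_def)

lemma controls_adapted: "I \<in> controls M F \<Longrightarrow> 0 \<le> t \<Longrightarrow> I t \<in> borel_measurable (F (ennreal t))"
  by (auto simp: controls_def adapted_def)

lemma controls_uminus: "I \<in> controls M F \<Longrightarrow> (\<lambda>t \<omega>. - I t \<omega>) \<in> controls M F"
  using bv_path.bv_path_uminus[OF controls_bv] controls_adapted by (intro controlsI) auto

lemma pos_variation_adapted:
  assumes I: "I \<in> controls M F" and t: "0 \<le> t"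
  shows "(\<lambda>\<omega>. pos_variation (\<lambda>t. I t \<omega>) t) \<in> borel_measurable (F (ennreal t))"
proof (rule borel_measurable_pos_variation)
  show "I s \<in> borel_measurable (F (ennreal t))" if "0 \<le> s" "s \<le> t" for s
    using controls_adapted[OF I that(1)]
    by (rule measurable_mono[THEN subsetD, OF order_refl refl, rotated -1])
      (use that sets_F_mono in \<open>simp_all add: space_F ennreal_leI\<close>)
qed (use controls_bv[OF I] in \<open>auto simp: space_F\<close>)

lemma stopping_time_pos:
  assumes I: "I \<in> controls M F"
  shows "stopping_time F (\<lambda>\<omega>. first_positive_time (pos_variation (\<lambda>t. I t \<omega>)))"
proof -
  have "stopping_time F (\<lambda>\<omega>. first_positive_time (\<lambda>t. pos_variation (\<lambda>t. I t \<omega>) t))"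
    by (rule stopping_time_first_positive_time[OF filtration_axioms F_right pos_variation_adapted[OF I]])
      (auto intro: bv_path.pos_mono controls_bv[OF I])
  then show ?thesis by simp
qed

lemma measurable_control:
  assumes I: "I \<in> controls M F"
  shows "(\<lambda>p. I (max 0 (snd p)) (fst p)) \<in> borel_measurable (M \<Otimes>\<^sub>M borel)"
proof -
  have "(\<lambda>(\<omega>, t). I (max 0 t) \<omega>) \<in> borel_measurable (M \<Otimes>\<^sub>M borel)"
    by (rule borel_measurable_right_continuous_process)
      (use I in \<open>auto simp: controls_def adapted_def cadlag_def intro: measurable_F_M\<close>)
  then show ?thesis by (simp add: split_beta')
qed

lemma measurable_pos_variation:
  assumes I: "I \<in> controls M F"
  shows "(\<lambda>p. pos_variation (\<lambda>t. I t (fst p)) (max 0 (snd p))) \<in> borel_measurable (M \<Otimes>\<^sub>M borel)"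
proof -
  have "(\<lambda>(\<omega>, t). pos_variation (\<lambda>t. I t \<omega>) (max 0 t)) \<in> borel_measurable (M \<Otimes>\<^sub>M borel)"
    using borel_measurable_right_continuous_process[of "\<lambda>t \<omega>. pos_variation (\<lambda>t. I t \<omega>) t" M]
      pos_variation_adapted[OF I] bv_path.pos_right_cont[OF controls_bv[OF I]]
    by (auto intro: measurable_F_M)
  then show ?thesis by (simp add: split_beta')
qed

lemma measurable_neg_variation:
  assumes I: "I \<in> controls M F"
  shows "(\<lambda>p. neg_variation (\<lambda>t. I t (fst p)) (max 0 (snd p))) \<in> borel_measurable (M \<Otimes>\<^sub>M borel)"
  using measurable_pos_variation[OF controls_uminus[OF I]] by (simp add: pos_variation_uminus)

section \<open>Costs as integrals over \<open>Q\<close>\<close>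

definition rate :: "real \<Rightarrow> (real \<Rightarrow> 'a \<Rightarrow> real) \<Rightarrow> 'a \<times> real \<Rightarrow> real" where
  "rate c I p = g (c + I (max 0 (snd p)) (fst p)) (X (max 0 (snd p)) (fst p))
     + \<rho> * (qp * pos_variation (\<lambda>t. I t (fst p)) (max 0 (snd p))
          + qm * neg_variation (\<lambda>t. I t (fst p)) (max 0 (snd p)))"

lemma measurable_rate:
  assumes I: "I \<in> controls M F"
  shows "rate c I \<in> borel_measurable Q"
proof -
  note [measurable] = measurable_control[OF I] measurable_pos_variation[OF I] measurable_neg_variation[OF I]
  have [measurable]: "(\<lambda>p. g (c + I (max 0 (snd p)) (fst p)) (X (max 0 (snd p)) (fst p)))
      \<in> borel_measurable (M \<Otimes>\<^sub>M borel)"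
    by (rule measurable_g_X) measurable
  show ?thesis unfolding rate_def[abs_def] by measurable
qed

lemma rate_nonneg:
  assumes I: "I \<in> controls M F" and p: "p \<in> space Q"
  shows "0 \<le> rate c I p"
proof -
  interpret bv_path "\<lambda>t. I t (fst p)"
    using p by (intro controls_bv[OF I]) (auto simp: space_pair_measure)
  show ?thesis
    using p unfolding rate_def
    by (intro add_nonneg_nonneg mult_nonneg_nonneg g_nonneg X_in pos_nonneg neg_nonneg)
      (use \<rho>_pos qp_pos qm_pos in \<open>auto simp: space_pair_measure\<close>)
qed

text \<open>The two sides agree path by path through
  \<open>nn_integral_exp_interval_measure\<close>, and Tonelli joins time and \<omega>. From here on
  two controls are compared pointwise through their rates, without Stieltjes integrals.\<close>

lemma cost_eq:
  assumes I: "I \<in> controls M F"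
  shows "cost c I = (\<integral>\<^sup>+p. ennreal (rate c I p) \<partial>Q)"
proof -
  let ?G = "\<lambda>\<omega> t. g (c + I (max 0 t) \<omega>) (X (max 0 t) \<omega>)"
  have "(\<integral>\<^sup>+t\<in>{0..}. ennreal (exp (- \<rho> * t) * g (c + I t \<omega>) (X t \<omega>)) \<partial>lborel)
        + ennreal qp * (\<integral>\<^sup>+t\<in>{0..}. ennreal (exp (- \<rho> * t))
            \<partial>interval_measure (ext0 (pos_variation (\<lambda>t. I t \<omega>))))
        + ennreal qm * (\<integral>\<^sup>+t\<in>{0..}. ennreal (exp (- \<rho> * t))
            \<partial>interval_measure (ext0 (neg_variation (\<lambda>t. I t \<omega>)))) =
        (\<integral>\<^sup>+t. ennreal (rate c I (\<omega>, t)) \<partial>disc_lborel \<rho>)" if \<omega>: "\<omega> \<in> space M" for \<omega>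
  proof -
    interpret bv_path "\<lambda>t. I t \<omega>" by (rule controls_bv[OF I \<omega>])
    let ?P = "pos_variation (\<lambda>t. I t \<omega>)" and ?N = "neg_variation (\<lambda>t. I t \<omega>)"
    have [measurable]: "?P \<in> borel_measurable borel" "?N \<in> borel_measurable borel"
      by (auto intro!: borel_measurable_mono pos_mono neg_mono)
    have "(\<lambda>p. g (c + I (max 0 (snd p)) (fst p)) (X (max 0 (snd p)) (fst p))) \<in> borel_measurable (M \<Otimes>\<^sub>M borel)"
      by (rule measurable_g_X) (use measurable_control[OF I] in measurable)
    from measurable_Pair2[OF this \<omega>] have G [measurable]: "?G \<omega> \<in> borel_measurable borel" by simp
    have G0: "0 \<le> ?G \<omega> t" for t by (intro g_nonneg X_in \<omega>) auto
    have 1: "(\<integral>\<^sup>+t\<in>{0..}. ennreal (exp (- \<rho> * t) * g (c + I t \<omega>) (X t \<omega>)) \<partial>lborel) =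
       (\<integral>\<^sup>+t. ennreal (?G \<omega> t) \<partial>disc_lborel \<rho>)"
      by (subst nn_integral_disc_lborel)
        (auto intro!: nn_integral_cong simp: indicator_def ennreal_mult'[symmetric])
    have 2: "(\<integral>\<^sup>+t\<in>{0..}. ennreal (exp (- \<rho> * t)) \<partial>interval_measure ?P) = (\<integral>\<^sup>+t. ennreal (\<rho> * ?P t) \<partial>disc_lborel \<rho>)"
      by (intro nn_integral_exp_interval_measure \<rho>_pos pos_mono pos_right_cont pos_variation_neg_time)
    have 3: "(\<integral>\<^sup>+t\<in>{0..}. ennreal (exp (- \<rho> * t)) \<partial>interval_measure ?N) = (\<integral>\<^sup>+t. ennreal (\<rho> * ?N t) \<partial>disc_lborel \<rho>)"
      by (intro nn_integral_exp_interval_measure \<rho>_pos neg_mono neg_right_cont neg_variation_neg_time)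
    have "(\<integral>\<^sup>+t. ennreal (rate c I (\<omega>, t)) \<partial>disc_lborel \<rho>) =
        (\<integral>\<^sup>+t. ennreal (?G \<omega> t) + ennreal qp * ennreal (\<rho> * ?P t) + ennreal qm * ennreal (\<rho> * ?N t) \<partial>disc_lborel \<rho>)"
    proof (intro nn_integral_cong_AE)
      \<comment> \<open>At negative times \<open>rate\<close> clamps to time 0 whereas
        \<open>?P\<close> and \<open>?N\<close> vanish, but those times carry no mass.\<close>
      show "AE t in disc_lborel \<rho>. ennreal (rate c I (\<omega>, t)) =
         ennreal (?G \<omega> t) + ennreal qp * ennreal (\<rho> * ?P t) + ennreal qm * ennreal (\<rho> * ?N t)"
        using AE_disc_lborel_nonneg[of \<rho>]
      proof eventually_elim
        case (elim t)
        then show ?case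
          using \<rho>_pos qp_pos qm_pos pos_nonneg[of t] neg_nonneg[of t] G0[of t]
          by (simp add: rate_def ennreal_mult'[symmetric] ennreal_plus[symmetric] algebra_simps
              del: ennreal_plus)
      qed
    qed
    then show ?thesis
      unfolding ext0_pos_variation ext0_neg_variation 1 2 3
      by (simp add: nn_integral_add nn_integral_cmult)
  qed
  then have "cost c I = (\<integral>\<^sup>+\<omega>. (\<integral>\<^sup>+t. ennreal (rate c I (\<omega>, t)) \<partial>disc_lborel \<rho>) \<partial>M)"
    unfolding total_cost_def by (intro nn_integral_cong) auto
  also have "\<dots> = (\<integral>\<^sup>+p. ennreal (rate c I p) \<partial>Q)"
    by (rule L.nn_integral_fst) (use measurable_rate[OF I] in measurable)
  finally show ?thesis .
qed

text \<open>The control that never acts has finite cost by \<open>g_integrable\<close>. Finiteness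
  makes \<open>enn2real (val c)\<close> the true value, since \<open>enn2real\<close> sends infinity
  to 0.\<close>

lemma val_finite: "val c < \<infinity>"
proof -
  let ?Z = "\<lambda>(t :: real) (\<omega> :: 'a). 0 :: real"
  note zero = difference_of_increasing[of "\<lambda>_. 0" "\<lambda>_. 0" "\<lambda>_. 0"]
  have bv: "bv_path (\<lambda>_. 0)" by (rule zero(1)) (auto intro: mono_onI)
  have Z: "?Z \<in> controls M F" by (intro controlsI bv) auto
  have pos: "pos_variation (\<lambda>_. 0) t = 0" if "0 \<le> t" for t
    using bv_path.pos_nonneg[OF bv, of t] zero(2)[of t] that by (auto intro: mono_onI antisym)
  have neg: "neg_variation (\<lambda>_. 0) t = 0" if "0 \<le> t" for t
    using pos[OF that] by (simp add: neg_variation_eq)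
  have "val c \<le> cost c ?Z" unfolding val_def by (rule INF_lower[OF Z])
  also have "\<dots> = (\<integral>\<^sup>+p. ennreal (g c (X (max 0 (snd p)) (fst p))) \<partial>Q)"
    by (simp add: cost_eq[OF Z] rate_def pos neg)
  also have "\<dots> < \<infinity>"
  proof -
    have "(\<integral>\<^sup>+p. ennreal (norm (g c (X (max 0 (snd p)) (fst p)))) \<partial>Q) < \<infinity>"
      using g_integrable[of c] by (simp add: integrable_iff_bounded split_beta')
    moreover have "(\<integral>\<^sup>+p. ennreal (g c (X (max 0 (snd p)) (fst p))) \<partial>Q) \<le>
        (\<integral>\<^sup>+p. ennreal (norm (g c (X (max 0 (snd p)) (fst p)))) \<partial>Q)"
      by (intro nn_integral_mono ennreal_leI) auto
    ultimately show ?thesis by (rule le_less_trans[rotated])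
  qed
  finally show ?thesis .
qed

lemma optimal_rate:
  assumes I: "I \<in> controls M F" and opt: "val c = cost c I"
  shows "integrable Q (rate c I)" and "enn2real (val c) = (\<integral>p. rate c I p \<partial>Q)"
proof -
  have fin: "(\<integral>\<^sup>+p. ennreal (rate c I p) \<partial>Q) < \<infinity>"
    using val_finite[of c] by (simp add: opt cost_eq[OF I])
  have AE: "AE p in Q. 0 \<le> rate c I p" using rate_nonneg[OF I] by auto
  show int: "integrable Q (rate c I)"
    by (rule integrableI_nonneg[OF measurable_rate[OF I] AE fin])
  show "enn2real (val c) = (\<integral>p. rate c I p \<partial>Q)"
    unfolding opt cost_eq[OF I] nn_integral_eq_integral[OF int AE]
    by (simp add: integral_nonneg_AE[OF AE])
qed

text \<open>The form in which competitors are used: a pointwise majorant \<open>h\<close> of the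
  rate stands in for the exact variations of \<open>I\<close>.\<close>

lemma val_le_integral:
  assumes I: "I \<in> controls M F" and int: "integrable Q h"
    and le: "\<And>p. p \<in> space Q \<Longrightarrow> rate c I p \<le> h p"
  shows "enn2real (val c) \<le> (\<integral>p. h p \<partial>Q)"
proof -
  have nn: "AE p in Q. 0 \<le> h p"
    using order_trans[OF rate_nonneg[OF I] le] by (intro AE_I2)
  have "val c \<le> cost c I" unfolding val_def by (rule INF_lower[OF I])
  also have "\<dots> \<le> (\<integral>\<^sup>+p. ennreal (h p) \<partial>Q)"
    unfolding cost_eq[OF I] by (intro nn_integral_mono ennreal_leI le)
  also have "\<dots> = ennreal (\<integral>p. h p \<partial>Q)" by (rule nn_integral_eq_integral[OF int nn])
  finally show ?thesis
    using integral_nonneg_AE[OF nn] by (simp add: enn2real_leI)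
qed

section \<open>The game payoff as an integral over \<open>Q\<close>\<close>

definition payoff_rate :: "real \<Rightarrow> ('a \<Rightarrow> ennreal) \<Rightarrow> ('a \<Rightarrow> ennreal) \<Rightarrow> 'a \<times> real \<Rightarrow> real" where
  "payoff_rate c \<sigma> \<tau> p = (let s = ennreal (max 0 (snd p)); a = \<sigma> (fst p); b = \<tau> (fst p) in
     (if s \<le> min a b then gc c (X (max 0 (snd p)) (fst p)) else 0)
     + (if a < b \<and> a \<le> s then \<rho> * qm else 0) - (if b < a \<and> b \<le> s then \<rho> * qp else 0))"

lemma measurable_stopping: "stopping_time F \<sigma> \<Longrightarrow> \<sigma> \<in> borel_measurable M"
  by (rule measurable_stopping_time[OF _ F_sub space_F])

lemma
  assumes \<sigma>: "stopping_time F \<sigma>" and \<tau>: "stopping_time F \<tau>"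
  shows integrable_payoff_rate: "integrable Q (payoff_rate c \<sigma> \<tau>)"
    and payoff_eq: "payoff c \<sigma> \<tau> = (\<integral>p. payoff_rate c \<sigma> \<tau> p \<partial>Q)"
proof -
  note [measurable] = measurable_stopping[OF \<sigma>] measurable_stopping[OF \<tau>] measurable_gc_X[of c]
  define R where "R p = (if ennreal (max 0 (snd p)) \<le> min (\<sigma> (fst p)) (\<tau> (fst p))
      then gc c (X (max 0 (snd p)) (fst p)) else 0)" for p
  define S where "S p = (if \<sigma> (fst p) < \<tau> (fst p) \<and> \<sigma> (fst p) \<le> ennreal (max 0 (snd p)) then \<rho> * qm else 0)" for p
  define T where "T p = (if \<tau> (fst p) < \<sigma> (fst p) \<and> \<tau> (fst p) \<le> ennreal (max 0 (snd p)) then \<rho> * qp else 0)" for p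
  have eq: "payoff_rate c \<sigma> \<tau> = (\<lambda>p. R p + S p - T p)"
    by (simp add: fun_eq_iff payoff_rate_def R_def S_def T_def Let_def)
  have mR: "R \<in> borel_measurable (M \<Otimes>\<^sub>M borel)" unfolding R_def[abs_def] by measurable
  have intR: "integrable Q R"
  proof (rule Bochner_Integration.integrable_bound[OF gc_integrable[of c]])
    show "R \<in> borel_measurable Q" using mR by measurable
  qed (auto simp: R_def)
  have intS: "integrable Q S"
    unfolding S_def by (rule Q.integrable_const_bound[where B="\<rho> * qm"]) (use \<rho>_pos qm_pos in auto)
  have intT: "integrable Q T"
    unfolding T_def by (rule Q.integrable_const_bound[where B="\<rho> * qp"]) (use \<rho>_pos qp_pos in auto)
  show int: "integrable Q (payoff_rate c \<sigma> \<tau>)"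
    unfolding eq by (intro Bochner_Integration.integrable_diff Bochner_Integration.integrable_add intR intS intT)
  have R_eq: "(LINT t:{t. 0 \<le> t \<and> ennreal t \<le> min (\<sigma> \<omega>) (\<tau> \<omega>)}|lborel. exp (- \<rho> * t) * gc c (X t \<omega>)) =
      (LINT t|disc_lborel \<rho>. R (\<omega>, t))" if \<omega>: "\<omega> \<in> space M" for \<omega>
    using measurable_Pair2[OF mR \<omega>]
    by (subst integral_disc_lborel)
      (auto simp: set_lebesgue_integral_def R_def indicator_def intro!: Bochner_Integration.integral_cong)
  have inner: "(LINT t|disc_lborel \<rho>. payoff_rate c \<sigma> \<tau> (\<omega>, t)) =
      (LINT t:{t. 0 \<le> t \<and> ennreal t \<le> min (\<sigma> \<omega>) (\<tau> \<omega>)}|lborel. exp (- \<rho> * t) * gc c (X t \<omega>))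
        + (if \<sigma> \<omega> < \<tau> \<omega> then qm * discount \<rho> (\<sigma> \<omega>) else 0)
        - (if \<tau> \<omega> < \<sigma> \<omega> then qp * discount \<rho> (\<tau> \<omega>) else 0)"
    if \<omega>: "\<omega> \<in> space M" and iR: "integrable (disc_lborel \<rho>) (\<lambda>t. R (\<omega>, t))" for \<omega>
  proof -
    have S: "(\<lambda>t. S (\<omega>, t)) = (if \<sigma> \<omega> < \<tau> \<omega> then (\<lambda>t. if \<sigma> \<omega> \<le> ennreal (max 0 t) then \<rho> * qm else 0) else (\<lambda>_. 0))"
      by (auto simp: S_def)
    have T: "(\<lambda>t. T (\<omega>, t)) = (if \<tau> \<omega> < \<sigma> \<omega> then (\<lambda>t. if \<tau> \<omega> \<le> ennreal (max 0 t) then \<rho> * qp else 0) else (\<lambda>_. 0))"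
      by (auto simp: T_def)
    have iS: "integrable (disc_lborel \<rho>) (\<lambda>t. S (\<omega>, t))" "integrable (disc_lborel \<rho>) (\<lambda>t. T (\<omega>, t))"
      unfolding S T using integral_disc_lborel_stop(1)[OF \<rho>_pos] by auto
    have "(LINT t|disc_lborel \<rho>. payoff_rate c \<sigma> \<tau> (\<omega>, t)) =
       (LINT t|disc_lborel \<rho>. R (\<omega>, t)) + (LINT t|disc_lborel \<rho>. S (\<omega>, t)) - (LINT t|disc_lborel \<rho>. T (\<omega>, t))"
      unfolding eq using iR iS by simp
    moreover have "(LINT t|disc_lborel \<rho>. S (\<omega>, t)) = (if \<sigma> \<omega> < \<tau> \<omega> then qm * discount \<rho> (\<sigma> \<omega>) else 0)"
      unfolding S using integral_disc_lborel_stop(2)[OF \<rho>_pos] \<rho>_pos by auto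
    moreover have "(LINT t|disc_lborel \<rho>. T (\<omega>, t)) = (if \<tau> \<omega> < \<sigma> \<omega> then qp * discount \<rho> (\<tau> \<omega>) else 0)"
      unfolding T using integral_disc_lborel_stop(2)[OF \<rho>_pos] \<rho>_pos by auto
    moreover have "(LINT t|disc_lborel \<rho>. R (\<omega>, t)) =
      (LINT t:{t. 0 \<le> t \<and> ennreal t \<le> min (\<sigma> \<omega>) (\<tau> \<omega>)}|lborel. exp (- \<rho> * t) * gc c (X t \<omega>))"
      by (rule R_eq[OF \<omega>, symmetric])
    ultimately show ?thesis by simp
  qed
  \<comment> \<open>Fubini gives integrability in time for almost every \<omega>, so the splitting
    in \<open>inner\<close> holds almost surely; the comparison of the outer integrals therefore
    asks for measurability of both integrands.\<close>
  have AE: "AE \<omega> in M. integrable (disc_lborel \<rho>) (\<lambda>t. R (\<omega>, t))"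
    by (rule MxL.AE_integrable_fst'[OF intR])
  have mR': "(\<lambda>\<omega>. LINT t|disc_lborel \<rho>. R (\<omega>, t)) \<in> borel_measurable M"
    using MxL.integrable_fst'[OF intR] by simp
  have "(\<integral>p. payoff_rate c \<sigma> \<tau> p \<partial>Q) = (LINT \<omega>|M. LINT t|disc_lborel \<rho>. payoff_rate c \<sigma> \<tau> (\<omega>, t))"
    by (rule MxL.integral_fst'[OF int, symmetric])
  also have "\<dots> = payoff c \<sigma> \<tau>"
    unfolding dynkin_payoff_def
  proof (rule integral_cong_AE)
    show "(\<lambda>\<omega>. LINT t|disc_lborel \<rho>. payoff_rate c \<sigma> \<tau> (\<omega>, t)) \<in> borel_measurable M"
      using MxL.integrable_fst'[OF int] by simp
    have [measurable]: "(\<lambda>\<omega>. LINT t:{t. 0 \<le> t \<and> ennreal t \<le> min (\<sigma> \<omega>) (\<tau> \<omega>)}|lborel. exp (- \<rho> * t) * gc c (X t \<omega>))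
        \<in> borel_measurable M"
      using mR' by (rule measurable_cong[THEN iffD1, rotated]) (simp only: R_eq)
    have [measurable]: "discount \<rho> \<in> borel_measurable borel"
      unfolding discount_def[abs_def] by measurable
    show "(\<lambda>\<omega>. (LINT t:{t. 0 \<le> t \<and> ennreal t \<le> min (\<sigma> \<omega>) (\<tau> \<omega>)}|lborel. exp (- \<rho> * t) * gc c (X t \<omega>))
        + (if \<sigma> \<omega> < \<tau> \<omega> then qm * discount \<rho> (\<sigma> \<omega>) else 0)
        - (if \<tau> \<omega> < \<sigma> \<omega> then qp * discount \<rho> (\<tau> \<omega>) else 0)) \<in> borel_measurable M"
      by measurable
  qed (use AE inner in auto)
  finally show "payoff c \<sigma> \<tau> = (\<integral>p. payoff_rate c \<sigma> \<tau> p \<partial>Q)" by simp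
qed

end

section \<open>Perturbation of an optimal control to the right\<close>

lemma right_continuous_stop_indicator:
  fixes k :: real
  assumes "0 \<le> t"
  shows "continuous (at_right t) (\<lambda>t. if a \<le> ennreal t then k else 0)"
proof (cases "a \<le> ennreal t")
  case True
  have "\<forall>\<^sub>F s in at_right t. (if a \<le> ennreal t then k else 0) = (if a \<le> ennreal s then k else 0)"
    using eventually_at_right_less[of t]
  proof eventually_elim
    case (elim s)
    then have "a \<le> ennreal s" using True by (meson ennreal_leI less_imp_le order_trans)
    then show ?case using True by simp
  qed
  then show ?thesis unfolding continuous_within by (rule Lim_transform_eventually[OF tendsto_const])
next
  case False
  then obtain r where r: "ennreal t < ennreal r" "ennreal r < a"
    using ennreal_rat_dense[of "ennreal t" a] by (auto simp: not_le)
  then have "t < r" using assms by (simp add: ennreal_less_iff)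
  then have "\<forall>\<^sub>F s in at_right t. s < r" by (auto simp: eventually_at_right)
  then have "\<forall>\<^sub>F s in at_right t. (if a \<le> ennreal t then k else 0) = (if a \<le> ennreal s then k else 0)"
  proof eventually_elim
    case (elim s)
    then have "ennreal s \<le> ennreal r" by (simp add: ennreal_leI)
    then have "\<not> a \<le> ennreal s" using r by auto
    then show ?case using False by simp
  qed
  then show ?thesis unfolding continuous_within by (rule Lim_transform_eventually[OF tendsto_const])
qed

context control_problem
begin

text \<open>
  Starting from \<open>c + \<epsilon>\<close>, keep the excess capacity over the optimal one, let the purchases of \<open>I\<close>
  absorb it, and sell it at time \<open>\<sigma>\<close> if \<open>I\<close> has not purchased by then.
\<close>

definition perturbed :: "(real \<Rightarrow> 'a \<Rightarrow> real) \<Rightarrow> ('a \<Rightarrow> ennreal) \<Rightarrow> real \<Rightarrow> real \<Rightarrow> 'a \<Rightarrow> real" where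
  "perturbed I \<sigma> \<epsilon> t \<omega> = I t \<omega> - \<epsilon> +
     (if \<sigma> \<omega> < first_positive_time (pos_variation (\<lambda>t. I t \<omega>)) \<and> \<sigma> \<omega> \<le> ennreal t then 0
      else max 0 (\<epsilon> - pos_variation (\<lambda>t. I t \<omega>) t))"

text \<open>Bounds the increase of the rate divided by \<epsilon>. The fraction
  \<open>min 1 (P s / \<epsilon>)\<close> of the excess has been absorbed and saves purchases; the
  rest costs at most \<open>gc (c + \<epsilon>)\<close> per unit. After a sale only its price, as
  the rate \<open>\<rho> * qm\<close>, remains.\<close>

definition slope ::
  "real \<Rightarrow> (real \<Rightarrow> 'a \<Rightarrow> real) \<Rightarrow> ('a \<Rightarrow> ennreal) \<Rightarrow> real \<Rightarrow> 'a \<times> real \<Rightarrow> real" where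
  "slope c I \<sigma> \<epsilon> p = (let s = max 0 (snd p); a = \<sigma> (fst p); P = pos_variation (\<lambda>t. I t (fst p));
       b = first_positive_time P in
     (if a < b \<and> a \<le> ennreal s then \<rho> * qm else max 0 (1 - P s / \<epsilon>) * gc (c + \<epsilon>) (X s (fst p)))
     - (if a < b then 0 else \<rho> * qp * min 1 (P s / \<epsilon>)))"

text \<open>The pointwise limit of \<open>slope\<close> as \<epsilon> tends to 0: any positive
  amount of purchases eventually absorbs the whole excess, so only the sign of \<open>P s\<close>
  survives.\<close>

definition slope_limit ::
  "real \<Rightarrow> (real \<Rightarrow> 'a \<Rightarrow> real) \<Rightarrow> ('a \<Rightarrow> ennreal) \<Rightarrow> 'a \<times> real \<Rightarrow> real" where
  "slope_limit c I \<sigma> p = (let s = max 0 (snd p); a = \<sigma> (fst p); P = pos_variation (\<lambda>t. I t (fst p));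
       b = first_positive_time P in
     (if a < b \<and> a \<le> ennreal s then \<rho> * qm else if P s \<le> 0 then gc c (X s (fst p)) else 0)
     - (if a < b \<or> P s \<le> 0 then 0 else \<rho> * qp))"

lemma zero_before_first_positive_time:
  assumes "bv_path f" "0 \<le> t" "ennreal t < first_positive_time (pos_variation f)"
  shows "pos_variation f t = 0"
proof (rule ccontr)
  assume "pos_variation f t \<noteq> 0"
  then have "0 < pos_variation f t" using bv_path.pos_nonneg[OF assms(1), of t] by simp
  then have "first_positive_time (pos_variation f) \<le> ennreal t"
    unfolding first_positive_time_def using assms(2) by (intro Inf_lower) auto
  then show False using assms(3) by simp
qed

text \<open>On paths with \<open>\<sigma> \<omega> < b\<close> all purchases of \<open>I\<close> are
  kept and the sale adds \<epsilon> to the decreasing part; on the others the first \<epsilon> units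
  of purchases are dropped.\<close>

lemma perturbed_path:
  assumes bv: "bv_path (\<lambda>t. I t \<omega>)" and \<epsilon>: "0 < \<epsilon>"
  defines "P \<equiv> pos_variation (\<lambda>t. I t \<omega>)" and "N \<equiv> neg_variation (\<lambda>t. I t \<omega>)"
  defines "b \<equiv> first_positive_time P"
  shows "bv_path (\<lambda>t. perturbed I \<sigma> \<epsilon> t \<omega>)"
    and "0 \<le> t \<Longrightarrow> pos_variation (\<lambda>t. perturbed I \<sigma> \<epsilon> t \<omega>) t \<le>
      P t - (if \<sigma> \<omega> < b then 0 else min \<epsilon> (P t))"
    and "0 \<le> t \<Longrightarrow> neg_variation (\<lambda>t. perturbed I \<sigma> \<epsilon> t \<omega>) t \<le>
      N t + (if \<sigma> \<omega> < b then if \<sigma> \<omega> \<le> ennreal t then \<epsilon> else 0 else 0)"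
proof -
  interpret bv_path "\<lambda>t. I t \<omega>" by (rule bv)
  let ?A = "\<lambda>t. P t - (if \<sigma> \<omega> < b then 0 else min \<epsilon> (P t))"
  let ?B = "\<lambda>t. N t + (if \<sigma> \<omega> < b then if \<sigma> \<omega> \<le> ennreal t then \<epsilon> else 0 else 0)"
  have mono: "P x \<le> P y" "N x \<le> N y" if "x \<le> y" for x y
    using that pos_mono neg_mono by (auto simp: P_def N_def dest: monoD)
  have A: "mono_on {0..} ?A" "?A 0 \<ge> 0" "\<And>t. 0 \<le> t \<Longrightarrow> continuous (at_right t) ?A"
  proof -
    show "mono_on {0..} ?A"
      by (rule mono_onI) (use mono in \<open>fastforce simp: min_def\<close>)
    show "?A 0 \<ge> 0" using pos_nonneg[of 0] by (simp add: P_def)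
    show "continuous (at_right t) ?A" for t
      using pos_right_cont[of t] by (cases "\<sigma> \<omega> < b") (auto simp: P_def intro!: continuous_intros)
  qed
  have B: "mono_on {0..} ?B" "?B 0 \<ge> 0" "\<And>t. 0 \<le> t \<Longrightarrow> continuous (at_right t) ?B"
  proof -
    show "mono_on {0..} ?B"
    proof (rule mono_onI)
      fix x y :: real assume "x \<le> y"
      then have "N x \<le> N y" "ennreal x \<le> ennreal y" by (auto intro: mono ennreal_leI)
      then show "?B x \<le> ?B y" using \<epsilon> by auto
    qed
    show "?B 0 \<ge> 0" using neg_nonneg[of 0] \<epsilon> by (simp add: N_def)
    show "continuous (at_right t) ?B" if "0 \<le> t" for t
      using neg_right_cont[of t] right_continuous_stop_indicator[OF that, of "\<sigma> \<omega>" \<epsilon>]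
      by (cases "\<sigma> \<omega> < b") (auto simp: N_def intro!: continuous_intros)
  qed
  have eq: "perturbed I \<sigma> \<epsilon> t \<omega> = ?A t - ?B t" if t: "0 \<le> t" for t
  proof -
    have I: "I t \<omega> = P t - N t" unfolding P_def N_def by (rule jordan'[OF t])
    \<comment> \<open>Before a sale no purchase has taken place, so the excess is still exactly
      \<epsilon>.\<close>
    have "P t = 0" if "\<sigma> \<omega> < b" "\<not> \<sigma> \<omega> \<le> ennreal t"
      unfolding P_def
      by (rule zero_before_first_positive_time[OF bv_path_axioms t]) (use that in \<open>auto simp: b_def P_def\<close>)
    then show ?thesis
      using \<epsilon> unfolding perturbed_def P_def[symmetric] b_def[symmetric] I by auto
  qed
  note D = difference_of_increasing[OF A B eq]
  show "bv_path (\<lambda>t. perturbed I \<sigma> \<epsilon> t \<omega>)" by (rule D(1))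
  show "0 \<le> t \<Longrightarrow> pos_variation (\<lambda>t. perturbed I \<sigma> \<epsilon> t \<omega>) t \<le> ?A t" by (rule D(2))
  show "0 \<le> t \<Longrightarrow> neg_variation (\<lambda>t. perturbed I \<sigma> \<epsilon> t \<omega>) t \<le> ?B t" by (rule D(3))
qed

text \<open>The point is adaptedness: once \<sigma> has occurred it must be known whether it came
  before the first purchase. This holds because that event belongs to the \<sigma>-algebra of the
  past of \<sigma>.\<close>

lemma perturbed_in_controls:
  assumes I: "I \<in> controls M F" and \<sigma>: "stopping_time F \<sigma>" and \<epsilon>: "0 < \<epsilon>"
  shows "perturbed I \<sigma> \<epsilon> \<in> controls M F"
proof (rule controlsI)
  fix t :: real assume t: "0 \<le> t"
  let ?\<tau> = "\<lambda>\<omega>. first_positive_time (pos_variation (\<lambda>t. I t \<omega>))"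
  have "{\<omega>\<in>space (pre_sigma \<sigma>). \<sigma> \<omega> < ?\<tau> \<omega>} \<in> sets (pre_sigma \<sigma>)"
    using stopping_time_less[OF \<sigma> stopping_time_pos[OF I]] by (simp add: pred_def)
  from sets_pre_sigmaD[OF \<sigma> this, of "ennreal t"]
  have [measurable]: "Measurable.pred (F (ennreal t)) (\<lambda>\<omega>. \<sigma> \<omega> < ?\<tau> \<omega> \<and> \<sigma> \<omega> \<le> ennreal t)"
    by (simp add: pred_def space_pre_sigma space_F conj_assoc)
  note [measurable] = controls_adapted[OF I t] pos_variation_adapted[OF I t]
  show "perturbed I \<sigma> \<epsilon> t \<in> borel_measurable (F (ennreal t))"
    unfolding perturbed_def[abs_def] by measurable
qed (rule perturbed_path(1)[OF controls_bv[OF I] \<epsilon>])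

text \<open>Where the excess has been sold or fully absorbed, the two capacities coincide. Elsewhere
  the perturbed one is larger by \<open>\<epsilon> - P s\<close>, which convexity of
  \<open>g\<close> prices.\<close>

lemma rate_perturbed_le:
  assumes I: "I \<in> controls M F" and \<epsilon>: "0 < \<epsilon>" and p: "p \<in> space Q"
  shows "rate (c + \<epsilon>) (perturbed I \<sigma> \<epsilon>) p \<le> rate c I p + \<epsilon> * slope c I \<sigma> \<epsilon> p"
proof -
  define s \<omega> where "s = max 0 (snd p)" and "\<omega> = fst p"
  have \<omega>: "\<omega> \<in> space M" and s: "0 \<le> s" using p by (auto simp: s_def \<omega>_def space_pair_measure)
  define P N where "P = pos_variation (\<lambda>t. I t \<omega>)" and "N = neg_variation (\<lambda>t. I t \<omega>)"
  define b where "b = first_positive_time P"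
  interpret bv_path "\<lambda>t. I t \<omega>" by (rule controls_bv[OF I \<omega>])
  have x: "X s \<omega> \<in> U" by (rule X_in[OF \<omega> s])
  have Is: "I s \<omega> = P s - N s" unfolding P_def N_def by (rule jordan'[OF s])
  have N0: "0 \<le> N s" unfolding N_def by (rule neg_nonneg)
  have "g (c + \<epsilon> + perturbed I \<sigma> \<epsilon> s \<omega>) (X s \<omega>) - g (c + I s \<omega>) (X s \<omega>) \<le>
      (if \<sigma> \<omega> < b \<and> \<sigma> \<omega> \<le> ennreal s then 0 else max 0 (\<epsilon> - P s) * gc (c + \<epsilon>) (X s \<omega>))"
  proof (cases "(\<sigma> \<omega> < b \<and> \<sigma> \<omega> \<le> ennreal s) \<or> \<epsilon> \<le> P s")
    case True
    then have "perturbed I \<sigma> \<epsilon> s \<omega> = I s \<omega> - \<epsilon>"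
      unfolding perturbed_def P_def[symmetric] b_def[symmetric] by auto
    then show ?thesis using True by auto
  next
    case False
    then have K: "perturbed I \<sigma> \<epsilon> s \<omega> = - N s"
      unfolding perturbed_def P_def[symmetric] b_def[symmetric] Is by auto
    \<comment> \<open>The tangent is taken at the larger capacity, so that it bounds the increase
      from above; as \<open>N s\<close> is nonnegative, the slope there is at most the one at
      \<open>c + \<epsilon>\<close>.\<close>
    have "gc (c + \<epsilon> - N s) (X s \<omega>) * ((c + I s \<omega>) - (c + \<epsilon> - N s)) \<le>
        g (c + I s \<omega>) (X s \<omega>) - g (c + \<epsilon> - N s) (X s \<omega>)"
      by (rule tangent[OF x])
    then have "g (c + \<epsilon> - N s) (X s \<omega>) - g (c + I s \<omega>) (X s \<omega>) \<le> (\<epsilon> - P s) * gc (c + \<epsilon> - N s) (X s \<omega>)"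
      by (simp add: Is algebra_simps)
    also have "\<dots> \<le> (\<epsilon> - P s) * gc (c + \<epsilon>) (X s \<omega>)"
      by (intro mult_left_mono gc_mono[OF x]) (use False N0 in auto)
    finally show ?thesis using False K by auto
  qed
  moreover have "qp * pos_variation (\<lambda>t. perturbed I \<sigma> \<epsilon> t \<omega>) s \<le>
      qp * (P s - (if \<sigma> \<omega> < b then 0 else min \<epsilon> (P s)))"
    unfolding P_def b_def
    by (intro mult_left_mono perturbed_path(2)[where I=I and \<omega>=\<omega>] bv_path_axioms \<epsilon> s less_imp_le[OF qp_pos])
  moreover have "qm * neg_variation (\<lambda>t. perturbed I \<sigma> \<epsilon> t \<omega>) s \<le>
      qm * (N s + (if \<sigma> \<omega> < b then if \<sigma> \<omega> \<le> ennreal s then \<epsilon> else 0 else 0))"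
    unfolding P_def b_def N_def
    by (intro mult_left_mono perturbed_path(3)[where I=I and \<omega>=\<omega>] bv_path_axioms \<epsilon> s less_imp_le[OF qm_pos])
  ultimately have "rate (c + \<epsilon>) (perturbed I \<sigma> \<epsilon>) p - rate c I p \<le>
      (if \<sigma> \<omega> < b \<and> \<sigma> \<omega> \<le> ennreal s then 0 else max 0 (\<epsilon> - P s) * gc (c + \<epsilon>) (X s \<omega>))
      + \<rho> * (- qp * (if \<sigma> \<omega> < b then 0 else min \<epsilon> (P s))
           + qm * (if \<sigma> \<omega> < b then if \<sigma> \<omega> \<le> ennreal s then \<epsilon> else 0 else 0))"
  proof -
    assume 1: "g (c + \<epsilon> + perturbed I \<sigma> \<epsilon> s \<omega>) (X s \<omega>) - g (c + I s \<omega>) (X s \<omega>) \<le>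
        (if \<sigma> \<omega> < b \<and> \<sigma> \<omega> \<le> ennreal s then 0 else max 0 (\<epsilon> - P s) * gc (c + \<epsilon>) (X s \<omega>))"
      and "qp * pos_variation (\<lambda>t. perturbed I \<sigma> \<epsilon> t \<omega>) s \<le>
        qp * (P s - (if \<sigma> \<omega> < b then 0 else min \<epsilon> (P s)))"
      and "qm * neg_variation (\<lambda>t. perturbed I \<sigma> \<epsilon> t \<omega>) s \<le>
        qm * (N s + (if \<sigma> \<omega> < b then if \<sigma> \<omega> \<le> ennreal s then \<epsilon> else 0 else 0))"
    then have "qp * pos_variation (\<lambda>t. perturbed I \<sigma> \<epsilon> t \<omega>) s + qm * neg_variation (\<lambda>t. perturbed I \<sigma> \<epsilon> t \<omega>) s
        - (qp * P s + qm * N s) \<le> - qp * (if \<sigma> \<omega> < b then 0 else min \<epsilon> (P s))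
           + qm * (if \<sigma> \<omega> < b then if \<sigma> \<omega> \<le> ennreal s then \<epsilon> else 0 else 0)"
      by (simp add: algebra_simps)
    from mult_left_mono[OF this less_imp_le[OF \<rho>_pos]] 1 show ?thesis
      unfolding rate_def s_def[symmetric] \<omega>_def[symmetric] P_def[symmetric] N_def[symmetric]
      by (simp only: right_diff_distrib)
  qed
  also have "\<dots> = \<epsilon> * slope c I \<sigma> \<epsilon> p"
  proof -
    have "max 0 (\<epsilon> - P s) = \<epsilon> * max 0 (1 - P s / \<epsilon>)" "min \<epsilon> (P s) = \<epsilon> * min 1 (P s / \<epsilon>)"
      using \<epsilon> by (auto simp: max_def min_def field_simps)
    then show ?thesis
      unfolding slope_def Let_def s_def[symmetric] \<omega>_def[symmetric] P_def[symmetric] b_def[symmetric]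
      by (simp add: algebra_simps)
  qed
  finally show ?thesis by simp
qed

lemma measurable_slope:
  assumes I: "I \<in> controls M F" and \<sigma>: "stopping_time F \<sigma>"
  shows "slope c I \<sigma> \<epsilon> \<in> borel_measurable Q" and "slope_limit c I \<sigma> \<in> borel_measurable Q"
proof -
  note [measurable] = measurable_stopping[OF \<sigma>] measurable_stopping[OF stopping_time_pos[OF I]]
    measurable_gc_X measurable_pos_variation[OF I]
  show "slope c I \<sigma> \<epsilon> \<in> borel_measurable Q"
    unfolding slope_def[abs_def] Let_def by measurable
  show "slope_limit c I \<sigma> \<in> borel_measurable Q"
    unfolding slope_limit_def[abs_def] Let_def by measurable
qed

text \<open>For \<epsilon> in (0,1], \<open>gc (c + \<epsilon>)\<close> lies between
  \<open>gc c\<close> and \<open>gc (c + 1)\<close> by monotonicity, which gives a dominating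
  function free of \<epsilon>.\<close>

definition slope_bound :: "real \<Rightarrow> 'a \<times> real \<Rightarrow> real" where
  "slope_bound c p = \<bar>gc c (X (max 0 (snd p)) (fst p))\<bar> + \<bar>gc (c + 1) (X (max 0 (snd p)) (fst p))\<bar>
     + \<rho> * qm + \<rho> * qp"

lemma integrable_slope_bound: "integrable Q (slope_bound c)"
  unfolding slope_bound_def[abs_def]
  using integrable_abs[OF gc_integrable[of c]] integrable_abs[OF gc_integrable[of "c + 1"]]
  by (intro Bochner_Integration.integrable_add Q.integrable_const) (simp_all add: split_beta')

lemma slope_le_bound:
  assumes I: "I \<in> controls M F" and \<epsilon>: "0 < \<epsilon>" "\<epsilon> \<le> 1" and p: "p \<in> space Q"
  shows "\<bar>slope c I \<sigma> \<epsilon> p\<bar> \<le> slope_bound c p"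
proof -
  define s \<omega> where "s = max 0 (snd p)" and "\<omega> = fst p"
  have \<omega>: "\<omega> \<in> space M" and s: "0 \<le> s" using p by (auto simp: s_def \<omega>_def space_pair_measure)
  define P where "P = pos_variation (\<lambda>t. I t \<omega>)"
  define b where "b = first_positive_time P"
  have x: "X s \<omega> \<in> U" by (rule X_in[OF \<omega> s])
  have P: "0 \<le> P s" unfolding P_def by (rule bv_path.pos_nonneg[OF controls_bv[OF I \<omega>]])
  have "gc c (X s \<omega>) \<le> gc (c + \<epsilon>) (X s \<omega>)" "gc (c + \<epsilon>) (X s \<omega>) \<le> gc (c + 1) (X s \<omega>)"
    using \<epsilon> by (auto intro!: gc_mono[OF x])
  then have "\<bar>gc (c + \<epsilon>) (X s \<omega>)\<bar> \<le> \<bar>gc c (X s \<omega>)\<bar> + \<bar>gc (c + 1) (X s \<omega>)\<bar>" by linarith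
  moreover have "\<bar>max 0 (1 - P s / \<epsilon>) * gc (c + \<epsilon>) (X s \<omega>)\<bar> \<le> 1 * \<bar>gc (c + \<epsilon>) (X s \<omega>)\<bar>"
    unfolding abs_mult using P \<epsilon> by (intro mult_right_mono) auto
  moreover have "0 \<le> \<rho> * qp * min 1 (P s / \<epsilon>)" "\<rho> * qp * min 1 (P s / \<epsilon>) \<le> \<rho> * qp * 1"
    using P \<epsilon> \<rho>_pos qp_pos by (auto intro!: mult_left_mono mult_nonneg_nonneg simp: min_def)
  moreover have "0 \<le> \<rho> * qm" using \<rho>_pos qm_pos by simp
  moreover have "\<bar>(if C then k else u) - (if D then 0 else v)\<bar> \<le> B + k + l"
    if "\<bar>u\<bar> \<le> B" "0 \<le> k" "0 \<le> v" "v \<le> l" for C D and u v k l B :: real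
    using that by auto
  ultimately show ?thesis
    unfolding slope_def slope_bound_def Let_def s_def[symmetric] \<omega>_def[symmetric] P_def[symmetric]
      b_def[symmetric]
    by simp
qed

lemma slope_tendsto:
  assumes I: "I \<in> controls M F" and p: "p \<in> space Q" and S: "\<And>n. 0 < S n" "S \<longlonglongrightarrow> 0"
  shows "(\<lambda>n. slope c I \<sigma> (S n) p) \<longlonglongrightarrow> slope_limit c I \<sigma> p"
proof -
  define s \<omega> where "s = max 0 (snd p)" and "\<omega> = fst p"
  have \<omega>: "\<omega> \<in> space M" and s: "0 \<le> s" using p by (auto simp: s_def \<omega>_def space_pair_measure)
  define P where "P = pos_variation (\<lambda>t. I t \<omega>)"
  define b where "b = first_positive_time P"
  have x: "X s \<omega> \<in> U" by (rule X_in[OF \<omega> s])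
  have P: "0 \<le> P s" unfolding P_def by (rule bv_path.pos_nonneg[OF controls_bv[OF I \<omega>]])
  have gc: "(\<lambda>n. gc (c + S n) (X s \<omega>)) \<longlonglongrightarrow> gc c (X s \<omega>)"
  proof -
    have "continuous_on UNIV (\<lambda>y. case (y, X s \<omega>) of (c, d) \<Rightarrow> gc c d)"
      by (rule continuous_on_compose2[OF gc_cont]) (use x in \<open>auto intro!: continuous_intros\<close>)
    then have "isCont (\<lambda>y. gc y (X s \<omega>)) c" by (simp add: continuous_on_eq_continuous_at)
    moreover have "(\<lambda>n. c + S n) \<longlonglongrightarrow> c" using tendsto_add[OF tendsto_const S(2), of c] by simp
    ultimately show ?thesis by (rule isCont_tendsto_compose)
  qed
  have lim: "(\<lambda>n. max 0 (1 - P s / S n)) \<longlonglongrightarrow> (if P s \<le> 0 then 1 else 0)"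
    "(\<lambda>n. min 1 (P s / S n)) \<longlonglongrightarrow> (if P s \<le> 0 then 0 else 1)"
  proof -
    have "\<forall>\<^sub>F n in sequentially. max 0 (1 - P s / S n) = (if P s \<le> 0 then 1 else 0)
        \<and> min 1 (P s / S n) = (if P s \<le> 0 then 0 else 1)"
    proof (cases "P s \<le> 0")
      case True
      then show ?thesis using P by simp
    next
      case False
      then have "\<forall>\<^sub>F n in sequentially. S n < P s" by (intro order_tendstoD(2)[OF S(2)]) simp
      then show ?thesis by eventually_elim (use False S(1) in \<open>auto simp: field_simps\<close>)
    qed
    then show "(\<lambda>n. max 0 (1 - P s / S n)) \<longlonglongrightarrow> (if P s \<le> 0 then 1 else 0)"
      "(\<lambda>n. min 1 (P s / S n)) \<longlonglongrightarrow> (if P s \<le> 0 then 0 else 1)"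
      by (simp_all only: tendsto_eventually eventually_conj_iff)
  qed
  have if_const: "(\<lambda>n. if C then k else f n) \<longlonglongrightarrow> (if C then k else l)" if "f \<longlonglongrightarrow> l"
    for C and k l :: real and f
    using that by simp
  have "(\<lambda>n. (if \<sigma> \<omega> < b \<and> \<sigma> \<omega> \<le> ennreal s then \<rho> * qm else max 0 (1 - P s / S n) * gc (c + S n) (X s \<omega>))
     - (if \<sigma> \<omega> < b then 0 else \<rho> * qp * min 1 (P s / S n))) \<longlonglongrightarrow>
     (if \<sigma> \<omega> < b \<and> \<sigma> \<omega> \<le> ennreal s then \<rho> * qm else (if P s \<le> 0 then 1 else 0) * gc c (X s \<omega>))
     - (if \<sigma> \<omega> < b then 0 else \<rho> * qp * (if P s \<le> 0 then 0 else 1))"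
    by (intro tendsto_diff if_const tendsto_mult lim gc tendsto_const)
  moreover have "slope_limit c I \<sigma> p =
     (if \<sigma> \<omega> < b \<and> \<sigma> \<omega> \<le> ennreal s then \<rho> * qm else (if P s \<le> 0 then 1 else 0) * gc c (X s \<omega>))
     - (if \<sigma> \<omega> < b then 0 else \<rho> * qp * (if P s \<le> 0 then 0 else 1))"
    unfolding slope_limit_def Let_def s_def[symmetric] \<omega>_def[symmetric] P_def[symmetric] b_def[symmetric]
    by simp
  ultimately show ?thesis
    unfolding slope_def Let_def s_def[symmetric] \<omega>_def[symmetric] P_def[symmetric] b_def[symmetric]
    by simp
qed

lemma integral_slope_tendsto:
  assumes I: "I \<in> controls M F" and \<sigma>: "stopping_time F \<sigma>"
  shows "integrable Q (slope_limit c I \<sigma>)"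
    and "((\<lambda>\<epsilon>. \<integral>p. slope c I \<sigma> \<epsilon> p \<partial>Q) \<longlongrightarrow> (\<integral>p. slope_limit c I \<sigma> p \<partial>Q)) (at_right 0)"
proof -
  have *: "integrable Q (slope_limit c I \<sigma>) \<and>
      (\<lambda>n. \<integral>p. slope c I \<sigma> (S n) p \<partial>Q) \<longlonglongrightarrow> (\<integral>p. slope_limit c I \<sigma> p \<partial>Q)"
    if S: "\<And>n. 0 < S n" "\<And>n. S n < 1" "S \<longlonglongrightarrow> 0" for S :: "nat \<Rightarrow> real"
  proof
    have lim: "AE p in Q. (\<lambda>n. slope c I \<sigma> (S n) p) \<longlonglongrightarrow> slope_limit c I \<sigma> p"
      by (rule AE_I2) (rule slope_tendsto[OF I _ S(1,3)])
    have bnd: "AE p in Q. norm (slope c I \<sigma> (S n) p) \<le> slope_bound c p" for n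
      by (rule AE_I2) (simp add: slope_le_bound[OF I S(1) less_imp_le[OF S(2)]])
    show "integrable Q (slope_limit c I \<sigma>)"
      by (rule integrable_dominated_convergence[OF measurable_slope(2,1)[OF I \<sigma>] integrable_slope_bound lim bnd])
    show "(\<lambda>n. \<integral>p. slope c I \<sigma> (S n) p \<partial>Q) \<longlonglongrightarrow> (\<integral>p. slope_limit c I \<sigma> p \<partial>Q)"
      by (rule integral_dominated_convergence[OF measurable_slope(2,1)[OF I \<sigma>] integrable_slope_bound lim bnd])
  qed
  \<comment> \<open>Integrability of the limit follows from any one admissible sequence; the shift
    by 2 keeps all terms strictly below 1.\<close>
  have "(\<lambda>n. 1 / (real n + 2)) \<longlonglongrightarrow> 0"
    using LIMSEQ_ignore_initial_segment[OF lim_1_over_n[where 'a=real], of 2] by (simp add: add.commute)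
  from *[OF _ _ this] show "integrable Q (slope_limit c I \<sigma>)" by simp
  show "((\<lambda>\<epsilon>. \<integral>p. slope c I \<sigma> \<epsilon> p \<partial>Q) \<longlongrightarrow> (\<integral>p. slope_limit c I \<sigma> p \<partial>Q)) (at_right 0)"
    by (rule tendsto_at_right_sequentially[of 0 1]) (use * in auto)
qed

text \<open>At almost every time the integrands agree on paths where \<sigma> and \<tau> differ. On
  a tie at a finite time the game pays nothing from then on, while the slope limit still records the
  saving \<open>\<rho> * qp\<close>; hence an inequality.\<close>

lemma slope_limit_le_payoff:
  assumes I: "I \<in> controls M F" and \<sigma>: "stopping_time F \<sigma>"
  defines "\<tau> \<equiv> \<lambda>\<omega>. first_positive_time (pos_variation (\<lambda>t. I t \<omega>))"
  shows "(\<integral>p. slope_limit c I \<sigma> p \<partial>Q) \<le> payoff c \<sigma> \<tau>"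
proof -
  have \<tau>: "stopping_time F \<tau>" unfolding \<tau>_def by (rule stopping_time_pos[OF I])
  note [measurable] = measurable_slope(2)[OF I \<sigma>]
    borel_measurable_integrable[OF integrable_payoff_rate[OF \<sigma> \<tau>]]
  have "AE p in Q. slope_limit c I \<sigma> p \<le> payoff_rate c \<sigma> \<tau> p"
  proof (rule MxL.AE_pair_measure)
    show "{p \<in> space Q. slope_limit c I \<sigma> p \<le> payoff_rate c \<sigma> \<tau> p} \<in> sets Q" by measurable
    show "AE \<omega> in M. AE t in disc_lborel \<rho>. slope_limit c I \<sigma> (\<omega>, t) \<le> payoff_rate c \<sigma> \<tau> (\<omega>, t)"
    proof (rule AE_I2)
      fix \<omega> assume \<omega>: "\<omega> \<in> space M"
      define P where "P = pos_variation (\<lambda>t. I t \<omega>)"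
      interpret bv_path "\<lambda>t. I t \<omega>" by (rule controls_bv[OF I \<omega>])
      have \<tau>\<omega>: "\<tau> \<omega> = first_positive_time P" by (simp add: \<tau>_def P_def)
      \<comment> \<open>The times \<sigma> and \<tau> themselves are discarded, because
        \<open>P\<close> may or may not already be positive at its first positive time. An infinite
        stopping time makes \<open>enn2real\<close> equal to 0, and then only time 0 is
        lost.\<close>
      show "AE t in disc_lborel \<rho>. slope_limit c I \<sigma> (\<omega>, t) \<le> payoff_rate c \<sigma> \<tau> (\<omega>, t)"
        using AE_disc_lborel_nonneg[of \<rho>] AE_disc_lborel_neq[of "enn2real (\<sigma> \<omega>)" \<rho>]
          AE_disc_lborel_neq[of "enn2real (\<tau> \<omega>)" \<rho>]
      proof eventually_elim
        case (elim t)
        then have t: "0 \<le> t" "max 0 t = t" by auto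
        have neq: "ennreal t \<noteq> \<sigma> \<omega>" "ennreal t \<noteq> \<tau> \<omega>"
          using elim by (metis enn2real_ennreal)+
        have P: "P t \<le> 0 \<longleftrightarrow> ennreal t < \<tau> \<omega>"
        proof
          assume "ennreal t < \<tau> \<omega>"
          then show "P t \<le> 0"
            using zero_before_first_positive_time[OF bv_path_axioms t(1)] by (simp add: \<tau>\<omega> P_def)
        next
          assume P: "P t \<le> 0"
          show "ennreal t < \<tau> \<omega>"
          proof (rule ccontr)
            assume "\<not> ennreal t < \<tau> \<omega>"
            then have "first_positive_time P < ennreal t" using neq by (simp add: \<tau>\<omega>)
            then obtain r where "0 \<le> r" "ennreal r < ennreal t" "0 < P r"
              by (auto simp: first_positive_time_less_iff)
            then show False
              using P monoD[OF pos_mono, of r t] by (simp add: P_def ennreal_less_iff)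
          qed
        qed
        have \<rho>q: "0 \<le> \<rho> * qp" using \<rho>_pos qp_pos by simp
        have *: "\<sigma> \<omega> \<le> ennreal t \<longleftrightarrow> \<not> ennreal t < \<sigma> \<omega>" "\<tau> \<omega> \<le> ennreal t \<longleftrightarrow> \<not> ennreal t < \<tau> \<omega>"
          "ennreal t \<le> min (\<sigma> \<omega>) (\<tau> \<omega>) \<longleftrightarrow> ennreal t < \<sigma> \<omega> \<and> ennreal t < \<tau> \<omega>"
          using neq by (simp add: not_less, simp add: not_less, simp add: order.strict_iff_order)
        have "\<not> ennreal t < \<sigma> \<omega> \<Longrightarrow> ennreal t < \<tau> \<omega> \<Longrightarrow> \<sigma> \<omega> < \<tau> \<omega>"
          "\<sigma> \<omega> < \<tau> \<omega> \<Longrightarrow> \<not> \<tau> \<omega> < \<sigma> \<omega>"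
          by (simp_all add: not_less)
        then show ?case
          unfolding slope_limit_def payoff_rate_def Let_def fst_conv snd_conv t(2) P_def[symmetric]
            \<tau>\<omega>[symmetric] P *
          using \<rho>q by (simp split: if_split)
      qed
    qed
  qed
  then show ?thesis
    unfolding payoff_eq[OF \<sigma> \<tau>]
    by (rule integral_mono_AE[OF integral_slope_tendsto(1)[OF I \<sigma>] integrable_payoff_rate[OF \<sigma> \<tau>]])
qed

text \<open>The upper right derivative estimate in difference form; the margin \<eta> absorbs the
  error of the limit.\<close>

lemma val_forward:
  assumes I: "I \<in> controls M F" and opt: "val c = cost c I" and \<sigma>: "stopping_time F \<sigma>" and \<eta>: "0 < \<eta>"
  shows "\<forall>\<^sub>F \<epsilon> in at_right 0. enn2real (val (c + \<epsilon>)) \<le> enn2real (val c) +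
    \<epsilon> * (payoff c \<sigma> (\<lambda>\<omega>. first_positive_time (pos_variation (\<lambda>t. I t \<omega>))) + \<eta>)"
    (is "\<forall>\<^sub>F \<epsilon> in _. _ \<le> _ + _ * (?J + \<eta>)")
proof -
  have "(\<integral>p. slope_limit c I \<sigma> p \<partial>Q) < ?J + \<eta>"
    using slope_limit_le_payoff[OF I \<sigma>, of c] \<eta> by linarith
  from order_tendstoD(2)[OF integral_slope_tendsto(2)[OF I \<sigma>] this]
  have ev: "\<forall>\<^sub>F \<epsilon> in at_right 0. (\<integral>p. slope c I \<sigma> \<epsilon> p \<partial>Q) < ?J + \<eta>" .
  have "\<forall>\<^sub>F \<epsilon> :: real in at_right 0. \<epsilon> < 1" by (rule order_tendstoD(2)[OF tendsto_ident_at]) simp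
  with ev eventually_at_right_less[of 0] show ?thesis
  proof eventually_elim
    case (elim \<epsilon>)
    have int: "integrable Q (slope c I \<sigma> \<epsilon>)"
      by (rule Bochner_Integration.integrable_bound[OF integrable_slope_bound[of c] measurable_slope(1)[OF I \<sigma>]])
        (use elim slope_le_bound[OF I] in \<open>auto intro!: AE_I2 intro: order_trans[OF _ abs_ge_self]\<close>)
    have "enn2real (val (c + \<epsilon>)) \<le> (\<integral>p. rate c I p + \<epsilon> * slope c I \<sigma> \<epsilon> p \<partial>Q)"
    proof (rule val_le_integral)
      show "perturbed I \<sigma> \<epsilon> \<in> controls M F" by (rule perturbed_in_controls[OF I \<sigma>]) fact
    qed (use elim rate_perturbed_le[OF I] optimal_rate(1)[OF I opt] int in auto)
    also have "\<dots> = enn2real (val c) + \<epsilon> * (\<integral>p. slope c I \<sigma> \<epsilon> p \<partial>Q)"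
      using optimal_rate[OF I opt] int by simp
    also have "\<dots> \<le> enn2real (val c) + \<epsilon> * (?J + \<eta>)"
      using elim by (intro add_left_mono mult_left_mono) auto
    finally show ?case .
  qed
qed

end

section \<open>Midpoint convexity, reflection and the saddle point\<close>

context control_problem
begin

text \<open>The average of the two optimal controls competes at the average capacity:
  \<open>g\<close> is convex, and the variations of an average are at most the averages of the
  variations. Optimal controls at levels other than the given \<open>c\<close> enter here.\<close>

lemma val_midpoint:
  assumes I: "I \<in> controls M F" "val x = cost x I" and I': "I' \<in> controls M F" "val y = cost y I'"
  shows "2 * enn2real (val ((x + y) / 2)) \<le> enn2real (val x) + enn2real (val y)"
proof -
  define K where "K t \<omega> = (I t \<omega> + I' t \<omega>) / 2" for t \<omega>
  have path: "bv_path (\<lambda>t. K t \<omega>)"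
    "0 \<le> t \<Longrightarrow> pos_variation (\<lambda>t. K t \<omega>) t \<le> (pos_variation (\<lambda>t. I t \<omega>) t + pos_variation (\<lambda>t. I' t \<omega>) t) / 2"
    "0 \<le> t \<Longrightarrow> neg_variation (\<lambda>t. K t \<omega>) t \<le> (neg_variation (\<lambda>t. I t \<omega>) t + neg_variation (\<lambda>t. I' t \<omega>) t) / 2"
    if "\<omega> \<in> space M" for \<omega> t
  proof -
    interpret I: bv_path "\<lambda>t. I t \<omega>" by (rule controls_bv[OF I(1) that])
    interpret I': bv_path "\<lambda>t. I' t \<omega>" by (rule controls_bv[OF I'(1) that])
    let ?A = "\<lambda>t. (pos_variation (\<lambda>t. I t \<omega>) t + pos_variation (\<lambda>t. I' t \<omega>) t) / 2"
    let ?B = "\<lambda>t. (neg_variation (\<lambda>t. I t \<omega>) t + neg_variation (\<lambda>t. I' t \<omega>) t) / 2"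
    have A: "mono_on {0..} ?A" "?A 0 \<ge> 0" "\<And>t. 0 \<le> t \<Longrightarrow> continuous (at_right t) ?A"
      by (auto intro!: mono_onI add_mono add_nonneg_nonneg continuous_intros divide_right_mono I.pos_nonneg I'.pos_nonneg
          I.pos_right_cont I'.pos_right_cont monoD[OF I.pos_mono] monoD[OF I'.pos_mono])
    have B: "mono_on {0..} ?B" "?B 0 \<ge> 0" "\<And>t. 0 \<le> t \<Longrightarrow> continuous (at_right t) ?B"
      by (auto intro!: mono_onI add_mono add_nonneg_nonneg continuous_intros divide_right_mono I.neg_nonneg I'.neg_nonneg
          I.neg_right_cont I'.neg_right_cont monoD[OF I.neg_mono] monoD[OF I'.neg_mono])
    have "K t \<omega> = ?A t - ?B t" if "0 \<le> t" for t
      using I.jordan'[OF that] I'.jordan'[OF that] by (simp add: K_def field_simps)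
    note D = difference_of_increasing[OF A B this]
    show "bv_path (\<lambda>t. K t \<omega>)" by (rule D(1))
    show "0 \<le> t \<Longrightarrow> pos_variation (\<lambda>t. K t \<omega>) t \<le> ?A t" by (rule D(2))
    show "0 \<le> t \<Longrightarrow> neg_variation (\<lambda>t. K t \<omega>) t \<le> ?B t" by (rule D(3))
  qed
  have K: "K \<in> controls M F"
    using controls_adapted[OF I(1)] controls_adapted[OF I'(1)] path(1)
    by (intro controlsI) (auto simp: K_def[abs_def])
  have "enn2real (val ((x + y) / 2)) \<le> (\<integral>p. (rate x I p + rate y I' p) / 2 \<partial>Q)"
  proof (rule val_le_integral[OF K])
    fix p assume p: "p \<in> space Q"
    define s \<omega> where "s = max 0 (snd p)" and "\<omega> = fst p"
    have \<omega>: "\<omega> \<in> space M" and s: "0 \<le> s" using p by (auto simp: s_def \<omega>_def space_pair_measure)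
    have "g ((1 - 1/2) *\<^sub>R (x + I s \<omega>) + (1/2) *\<^sub>R (y + I' s \<omega>)) (X s \<omega>)
        \<le> (1 - 1/2) * g (x + I s \<omega>) (X s \<omega>) + 1/2 * g (y + I' s \<omega>) (X s \<omega>)"
      by (rule convex_onD[OF g_convex[OF X_in[OF \<omega> s]]]) auto
    moreover have "(1 - 1/2) *\<^sub>R (x + I s \<omega>) + (1/2) *\<^sub>R (y + I' s \<omega>) = (x + y) / 2 + K s \<omega>"
      by (simp add: K_def field_simps)
    ultimately have 1: "g ((x + y) / 2 + K s \<omega>) (X s \<omega>) \<le> (g (x + I s \<omega>) (X s \<omega>) + g (y + I' s \<omega>) (X s \<omega>)) / 2"
      by simp
    have "qp * pos_variation (\<lambda>t. K t \<omega>) s + qm * neg_variation (\<lambda>t. K t \<omega>) s \<le>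
        qp * ((pos_variation (\<lambda>t. I t \<omega>) s + pos_variation (\<lambda>t. I' t \<omega>) s) / 2) +
        qm * ((neg_variation (\<lambda>t. I t \<omega>) s + neg_variation (\<lambda>t. I' t \<omega>) s) / 2)"
      using qp_pos qm_pos by (intro add_mono mult_left_mono path(2,3)[OF \<omega> s]) auto
    from add_mono[OF 1 mult_left_mono[OF this less_imp_le[OF \<rho>_pos]]]
    show "rate ((x + y) / 2) K p \<le> (rate x I p + rate y I' p) / 2"
      unfolding rate_def s_def[symmetric] \<omega>_def[symmetric] by (simp add: field_simps)
  qed (use optimal_rate(1)[OF I] optimal_rate(1)[OF I'] in auto)
  also have "\<dots> = (enn2real (val x) + enn2real (val y)) / 2"
    using optimal_rate[OF I] optimal_rate[OF I'] by simp
  finally show ?thesis by simp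
qed

lemma reflected:
  "control_problem M F X U (\<lambda>c. g (- c)) (\<lambda>c d. - gc (- c) d) \<rho> qm qp"
proof unfold_locales
  show "convex_on UNIV (\<lambda>c. g (- c) d)" if "d \<in> U" for d
  proof (rule convex_onI)
    fix t x y :: real assume t: "0 < t" "t < 1"
    have "g ((1 - t) *\<^sub>R (- x) + t *\<^sub>R (- y)) d \<le> (1 - t) * g (- x) d + t * g (- y) d"
      by (rule convex_onD[OF g_convex[OF that]]) (use t in auto)
    then show "g (- ((1 - t) *\<^sub>R x + t *\<^sub>R y)) d \<le> (1 - t) * g (- x) d + t * g (- y) d"
      by (simp add: algebra_simps)
  qed simp
  show "((\<lambda>x. g (- x) d) has_real_derivative - gc (- c) d) (at c)" if "d \<in> U" for c d
    using DERIV_chain2[OF g_deriv[OF that] DERIV_minus[OF DERIV_ident], of c] by simp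
  have refl: "continuous_on (UNIV \<times> U) (\<lambda>p :: real \<times> real. (- fst p, snd p))"
    by (intro continuous_intros)
  show "continuous_on (UNIV \<times> U) (\<lambda>(c, d). g (- c) d)"
    using continuous_on_compose2[OF g_cont refl] by (simp add: split_beta' image_subset_iff mem_Times_iff)
  have "continuous_on (UNIV \<times> U) (\<lambda>p. gc (- fst p) (snd p))"
    using continuous_on_compose2[OF gc_cont refl] by (simp add: split_beta' image_subset_iff mem_Times_iff)
  then show "continuous_on (UNIV \<times> U) (\<lambda>(c, d). - gc (- c) d)"
    by (auto simp: split_beta' intro: continuous_on_minus)
  show "integrable Q (\<lambda>(\<omega>, t). - gc (- c) (X (max 0 t) \<omega>))" for c
    using Bochner_Integration.integrable_minus[OF gc_integrable[of "- c"]] by (simp add: split_beta')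
qed (use F_sub F_right X_adapted X_cont X_in open_U g_nonneg g_integrable \<rho>_pos qp_pos qm_pos in auto)

lemma cost_reflected:
  "total_cost M \<rho> qm qp (\<lambda>c. g (- c)) X (- c) (\<lambda>t \<omega>. - I t \<omega>) = cost c I"
  by (simp add: total_cost_def pos_variation_uminus neg_variation_uminus add.assoc add.commute[of "ennreal qm * _"]
      add.commute[of c])

text \<open>Negation maps the set of controls onto itself, so the infimum can be reindexed.\<close>

lemma val_reflected: "control_problem.val M F X (\<lambda>c. g (- c)) \<rho> qm qp (- c) = val c"
proof -
  have "(INF I\<in>controls M F. total_cost M \<rho> qm qp (\<lambda>c. g (- c)) X (- c) I) =
      (INF I\<in>(\<lambda>I t \<omega>. - I t \<omega>) ` controls M F. total_cost M \<rho> qm qp (\<lambda>c. g (- c)) X (- c) I)"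
  proof (rule arg_cong[where f="\<lambda>A. Inf (_ ` A)"])
    have "I \<in> (\<lambda>I t \<omega>. - I t \<omega>) ` controls M F" if "I \<in> controls M F" for I
      using controls_uminus[OF that] by (intro image_eqI[of _ _ "\<lambda>t \<omega>. - I t \<omega>"]) auto
    then show "controls M F = (\<lambda>I t \<omega>. - I t \<omega>) ` controls M F"
      using controls_uminus by auto
  qed
  then show ?thesis
    by (simp add: control_problem.val_def[OF reflected] val_def image_image cost_reflected)
qed

lemma payoff_reflected:
  "dynkin_payoff M \<rho> qm qp (\<lambda>c d. - gc (- c) d) X (- c) \<tau> \<sigma> = - payoff c \<sigma> \<tau>"
  unfolding dynkin_payoff_def Bochner_Integration.integral_minus[symmetric]
  by (intro Bochner_Integration.integral_cong refl)
    (simp add: min.commute set_lebesgue_integral_def)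

text \<open>This is \<open>val_forward\<close> for the reflected problem at \<open>- c\<close>.
  First purchases of \<open>- I\<close> are first sales of \<open>I\<close>, and the free stopping
  time now belongs to the other player.\<close>

lemma val_backward:
  assumes I: "I \<in> controls M F" and opt: "val c = cost c I" and \<tau>: "stopping_time F \<tau>" and \<eta>: "0 < \<eta>"
  shows "\<forall>\<^sub>F \<epsilon> in at_right 0. enn2real (val (c - \<epsilon>)) \<le> enn2real (val c) +
    \<epsilon> * (- payoff c (\<lambda>\<omega>. first_positive_time (neg_variation (\<lambda>t. I t \<omega>))) \<tau> + \<eta>)"
proof -
  interpret R: control_problem M F X U "\<lambda>c. g (- c)" "\<lambda>c d. - gc (- c) d" \<rho> qm qp by (rule reflected)
  have val: "R.val (- c + \<epsilon>) = val (c - \<epsilon>)" for \<epsilon>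
    using val_reflected[of "c - \<epsilon>"] by (simp add: algebra_simps)
  have opt': "R.val (- c) = R.cost (- c) (\<lambda>t \<omega>. - I t \<omega>)"
    unfolding val_reflected cost_reflected by (rule opt)
  show ?thesis
    using R.val_forward[OF controls_uminus[OF I] opt' \<tau> \<eta>]
    unfolding val val_reflected pos_variation_uminus payoff_reflected .
qed

text \<open>The third conclusion treats deviations of both players at once: taking \<sigma> =
  \<sigma>' or \<tau> = \<tau>' gives the two saddle inequalities.\<close>

theorem saddle_point:
  assumes ex: "\<And>c. \<exists>I\<in>controls M F. val c = cost c I"
    and I: "I \<in> controls M F" and opt: "val c = cost c I"
  defines "\<sigma>' \<equiv> \<lambda>\<omega>. first_positive_time (neg_variation (\<lambda>t. I t \<omega>))"
    and "\<tau>' \<equiv> \<lambda>\<omega>. first_positive_time (pos_variation (\<lambda>t. I t \<omega>))"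
  shows "stopping_time F \<sigma>'" and "stopping_time F \<tau>'"
    and "\<And>\<sigma> \<tau>. stopping_time F \<sigma> \<Longrightarrow> stopping_time F \<tau> \<Longrightarrow> payoff c \<sigma>' \<tau> \<le> payoff c \<sigma> \<tau>'"
    and "((\<lambda>x. enn2real (val x)) has_real_derivative payoff c \<sigma>' \<tau>') (at c)"
proof -
  let ?v = "\<lambda>x. enn2real (val x)"
  show \<tau>': "stopping_time F \<tau>'" unfolding \<tau>'_def by (rule stopping_time_pos[OF I])
  show \<sigma>': "stopping_time F \<sigma>'"
    using stopping_time_pos[OF controls_uminus[OF I]] by (simp add: \<sigma>'_def pos_variation_uminus)
  have mid: "2 * ?v c \<le> ?v (c + \<epsilon>) + ?v (c - \<epsilon>)" for \<epsilon>
  proof -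
    obtain I1 I2 where "I1 \<in> controls M F" "val (c + \<epsilon>) = cost (c + \<epsilon>) I1"
      "I2 \<in> controls M F" "val (c - \<epsilon>) = cost (c - \<epsilon>) I2"
      using ex by metis
    from val_midpoint[OF this] show ?thesis by simp
  qed
  have ev: "\<forall>\<^sub>F \<epsilon> in at_right 0. 0 < \<epsilon> \<and> ?v (c + \<epsilon>) \<le> ?v c + \<epsilon> * (payoff c \<sigma> \<tau>' + \<eta>) \<and>
      ?v (c - \<epsilon>) \<le> ?v c + \<epsilon> * (- payoff c \<sigma>' \<tau> + \<eta>)"
    if "stopping_time F \<sigma>" "stopping_time F \<tau>" "0 < \<eta>" for \<sigma> \<tau> \<eta>
    using eventually_at_right_less[of 0] val_forward[OF I opt that(1,3)] val_backward[OF I opt that(2,3)]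
    unfolding \<sigma>'_def \<tau>'_def by eventually_elim blast
  show "payoff c \<sigma>' \<tau> \<le> payoff c \<sigma> \<tau>'" if \<sigma>: "stopping_time F \<sigma>" and \<tau>: "stopping_time F \<tau>" for \<sigma> \<tau>
  proof (rule field_le_epsilon)
    fix \<eta> :: real assume "0 < \<eta>"
    then obtain \<epsilon> where \<epsilon>: "0 < \<epsilon>" "?v (c + \<epsilon>) \<le> ?v c + \<epsilon> * (payoff c \<sigma> \<tau>' + \<eta> / 2)"
      "?v (c - \<epsilon>) \<le> ?v c + \<epsilon> * (- payoff c \<sigma>' \<tau> + \<eta> / 2)"
      using eventually_happens'[OF trivial_limit_at_right_real ev[OF \<sigma> \<tau>, of "\<eta> / 2"]] by auto
    \<comment> \<open>The midpoint inequality forces the sum of the right and left upper bounds to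
      be nonnegative; their margins \<open>\<eta> / 2\<close> add up to \<eta>.\<close>
    then have "0 \<le> \<epsilon> * (payoff c \<sigma> \<tau>' + \<eta> / 2) + \<epsilon> * (- payoff c \<sigma>' \<tau> + \<eta> / 2)"
      using mid[of \<epsilon>] by linarith
    then have "0 \<le> \<epsilon> * (payoff c \<sigma> \<tau>' - payoff c \<sigma>' \<tau> + \<eta>)" by (simp add: algebra_simps)
    then have "0 \<le> payoff c \<sigma> \<tau>' - payoff c \<sigma>' \<tau> + \<eta>"
      using \<open>0 < \<epsilon>\<close> by (simp add: zero_le_mult_iff)
    then show "payoff c \<sigma>' \<tau> \<le> payoff c \<sigma> \<tau>' + \<eta>" by linarith
  qed
  show "(?v has_real_derivative payoff c \<sigma>' \<tau>') (at c)"
    unfolding DERIV_def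
  proof (rule tendstoI)
    fix \<eta> :: real assume \<eta>: "0 < \<eta>"
    define w where "w = payoff c \<sigma>' \<tau>'"
    obtain \<delta> where \<delta>: "0 < \<delta>" "\<And>\<epsilon>. 0 < \<epsilon> \<Longrightarrow> \<epsilon> < \<delta> \<Longrightarrow>
        ?v (c + \<epsilon>) \<le> ?v c + \<epsilon> * (w + \<eta> / 2) \<and> ?v (c - \<epsilon>) \<le> ?v c + \<epsilon> * (- w + \<eta> / 2)"
      using ev[OF \<sigma>' \<tau>', of "\<eta> / 2"] \<eta> unfolding w_def eventually_at_right[OF zero_less_one] by auto
    have "dist ((?v (c + h) - ?v c) / h) w < \<eta>" if h: "h \<noteq> 0" "dist h 0 < \<delta>" for h
    proof (cases "0 < h")
      case True
      \<comment> \<open>The upper bound is the estimate on the same side of \<open>c\<close>; the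
        lower bound combines the midpoint inequality with the estimate on the opposite side.\<close>
      then have "?v (c + h) - ?v c \<le> h * (w + \<eta> / 2)" "h * (w - \<eta> / 2) \<le> ?v (c + h) - ?v c"
        using \<delta>(2)[of h] mid[of h] h by (auto simp: algebra_simps)
      then have "(?v (c + h) - ?v c) / h \<le> w + \<eta> / 2" "w - \<eta> / 2 \<le> (?v (c + h) - ?v c) / h"
        using True by (simp_all add: field_simps)
      then show ?thesis using \<eta> unfolding dist_real_def by linarith
    next
      case False
      then have neg: "h < 0" using h by simp
      then have "?v (c + h) - ?v c \<le> - h * (- w + \<eta> / 2)" "- h * (- w - \<eta> / 2) \<le> ?v (c + h) - ?v c"
        using \<delta>(2)[of "- h"] mid[of "- h"] h by (auto simp: algebra_simps)
      then have "w - \<eta> / 2 \<le> (?v (c + h) - ?v c) / h" "(?v (c + h) - ?v c) / h \<le> w + \<eta> / 2"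
        using neg by (simp_all add: field_simps)
      then show ?thesis using \<eta> unfolding dist_real_def by linarith
    qed
    then show "\<forall>\<^sub>F h in at 0. dist ((?v (c + h) - ?v c) / h) (payoff c \<sigma>' \<tau>') < \<eta>"
      unfolding eventually_at w_def[symmetric] using \<delta>(1) by auto
  qed
qed

end

section \<open>The capacity problem\<close>

lemma open_open_interval: "open (open_interval l r)"
  unfolding open_interval_def by (intro open_Collect_conj open_Collect_less continuous_intros)

lemma abs_pow_nonneg: "0 \<le> abs_pow x \<nu>"
  by (simp add: abs_pow_def)

context capacity_setting
begin

lemma demand:
  assumes d: "d \<in> open_interval dmin dmax"
  shows "adapted F (D d)"
    and "\<And>\<omega>. \<omega> \<in> space M \<Longrightarrow> continuous_on {0..} (\<lambda>t. D d t \<omega>)"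
    and "\<And>\<omega> t. \<omega> \<in> space M \<Longrightarrow> 0 \<le> t \<Longrightarrow> D d t \<omega> \<in> open_interval dmin dmax"
  using D_solution[OF d] by (auto simp: sde_solution_def)

text \<open>Taking the expectation first, the moment bound grows like exp(K1 t), which the discount
  beats because \<rho> > K1. It is applied to both \<open>g\<close> and \<open>gc\<close>.\<close>

lemma integrable_demand:
  assumes d: "d \<in> open_interval dmin dmax"
    and h: "continuous_on (UNIV \<times> open_interval dmin dmax) (\<lambda>(c, d). h c d)"
    and bound: "\<And>x. x \<in> open_interval dmin dmax \<Longrightarrow> \<bar>h c x\<bar> \<le> \<gamma>0 c + \<eta>0 c * abs_pow x \<nu>"
  shows "integrable (M \<Otimes>\<^sub>M disc_lborel \<rho>) (\<lambda>(\<omega>, t). h c (D d (max 0 t) \<omega>))"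
proof -
  have \<rho>: "0 < \<rho>" "0 < \<rho> - K1" using rho by auto
  interpret L: finite_measure "disc_lborel \<rho>" by (rule finite_measure_disc_lborel[OF \<rho>(1)])
  interpret L': finite_measure "disc_lborel (\<rho> - K1)" by (rule finite_measure_disc_lborel[OF \<rho>(2)])
  interpret pair_sigma_finite M "disc_lborel \<rho>" ..
  have mD: "D d t \<in> borel_measurable M" if "0 \<le> t" for t
  proof -
    have "D d t \<in> borel_measurable (F (ennreal t))"
      using demand(1)[OF d] that by (simp add: adapted_def)
    then show ?thesis by (rule measurable_mono[THEN subsetD, OF order_refl refl F_sub space_F])
  qed
  have "(\<lambda>(\<omega>, t). D d (max 0 t) \<omega>) \<in> borel_measurable (M \<Otimes>\<^sub>M borel)"
  proof (rule borel_measurable_right_continuous_process[OF mD])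
    show "continuous (at_right t) (\<lambda>t. D d t \<omega>)" if "\<omega> \<in> space M" "0 \<le> t" for \<omega> t
      using demand(2)[OF d that(1)] that(2)
      by (auto simp: continuous_on_eq_continuous_within intro: continuous_within_subset)
  qed
  then have [measurable]: "(\<lambda>p. D d (max 0 (snd p)) (fst p)) \<in> borel_measurable (M \<Otimes>\<^sub>M borel)"
    by (simp add: split_beta')
  have [measurable]: "(\<lambda>x. abs_pow x \<nu>) \<in> borel_measurable borel"
    unfolding abs_pow_def by measurable
  have mh: "(\<lambda>p. h c (D d (max 0 (snd p)) (fst p))) \<in> borel_measurable (M \<Otimes>\<^sub>M borel)"
    by (rule borel_measurable_continuous_on_strip[OF open_open_interval h])
      (auto simp: space_pair_measure intro: demand(3)[OF d])
  define C where "C = K0 * (1 + abs_pow d \<nu>)"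
  have C: "0 \<le> C" unfolding C_def using K0_nonneg abs_pow_nonneg[of d \<nu>] by simp
  have "(\<integral>\<^sup>+p. ennreal (norm (h c (D d (max 0 (snd p)) (fst p)))) \<partial>(M \<Otimes>\<^sub>M disc_lborel \<rho>)) \<le>
      (\<integral>\<^sup>+p. ennreal (\<gamma>0 c) + ennreal (\<eta>0 c) * ennreal (abs_pow (D d (max 0 (snd p)) (fst p)) \<nu>) \<partial>(M \<Otimes>\<^sub>M disc_lborel \<rho>))"
  proof (rule nn_integral_mono)
    fix p assume "p \<in> space (M \<Otimes>\<^sub>M disc_lborel \<rho>)"
    then have "D d (max 0 (snd p)) (fst p) \<in> open_interval dmin dmax"
      by (auto simp: space_pair_measure intro: demand(3)[OF d])
    from ennreal_leI[OF bound[OF this]] growth_pos[of c]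
    show "ennreal (norm (h c (D d (max 0 (snd p)) (fst p)))) \<le>
       ennreal (\<gamma>0 c) + ennreal (\<eta>0 c) * ennreal (abs_pow (D d (max 0 (snd p)) (fst p)) \<nu>)"
      by (simp add: ennreal_plus ennreal_mult abs_pow_nonneg less_imp_le)
  qed
  also have "\<dots> = (\<integral>\<^sup>+t. (\<integral>\<^sup>+\<omega>. ennreal (\<gamma>0 c) + ennreal (\<eta>0 c) * ennreal (abs_pow (D d (max 0 t) \<omega>) \<nu>) \<partial>M) \<partial>disc_lborel \<rho>)"
    by (subst nn_integral_snd[symmetric]) auto
  also have "\<dots> \<le> (\<integral>\<^sup>+t. ennreal (\<gamma>0 c) + ennreal (\<eta>0 c) * (ennreal C * ennreal (exp (K1 * max 0 t))) \<partial>disc_lborel \<rho>)"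
  proof (rule nn_integral_mono)
    fix t :: real
    have [measurable]: "D d (max 0 t) \<in> borel_measurable M" by (rule mD) simp
    have "(\<integral>\<^sup>+\<omega>. ennreal (\<gamma>0 c) + ennreal (\<eta>0 c) * ennreal (abs_pow (D d (max 0 t) \<omega>) \<nu>) \<partial>M) =
        ennreal (\<gamma>0 c) + ennreal (\<eta>0 c) * (\<integral>\<^sup>+\<omega>. ennreal (abs_pow (D d (max 0 t) \<omega>) \<nu>) \<partial>M)"
      by (simp add: nn_integral_add nn_integral_cmult emeasure_space_1)
    also have "\<dots> \<le> ennreal (\<gamma>0 c) + ennreal (\<eta>0 c) * ennreal (C * exp (K1 * max 0 t))"
      unfolding C_def by (intro add_left_mono mult_left_mono D_moments[OF d]) auto
    finally show "(\<integral>\<^sup>+\<omega>. ennreal (\<gamma>0 c) + ennreal (\<eta>0 c) * ennreal (abs_pow (D d (max 0 t) \<omega>) \<nu>) \<partial>M)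
        \<le> ennreal (\<gamma>0 c) + ennreal (\<eta>0 c) * (ennreal C * ennreal (exp (K1 * max 0 t)))"
      using C by (simp add: ennreal_mult)
  qed
  also have "\<dots> = ennreal (\<gamma>0 c) * emeasure (disc_lborel \<rho>) (space (disc_lborel \<rho>))
      + ennreal (\<eta>0 c) * (ennreal C * (\<integral>\<^sup>+t. ennreal (exp (K1 * max 0 t)) \<partial>disc_lborel \<rho>))"
    by (simp add: nn_integral_add nn_integral_cmult)
  \<comment> \<open>The growth factor merges with the discount into one at the positive rate
    \<open>\<rho> - K1\<close>, so the integral is a finite total mass.\<close>
  also have "(\<integral>\<^sup>+t. ennreal (exp (K1 * max 0 t)) \<partial>disc_lborel \<rho>) = (\<integral>\<^sup>+t. 1 \<partial>disc_lborel (\<rho> - K1))"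
    by (subst (1 2) nn_integral_disc_lborel)
      (auto intro!: nn_integral_cong simp: indicator_def ennreal_mult'[symmetric] exp_add[symmetric] algebra_simps)
  also have "(\<integral>\<^sup>+t. 1 \<partial>disc_lborel (\<rho> - K1)) = emeasure (disc_lborel (\<rho> - K1)) (space (disc_lborel (\<rho> - K1)))"
    by simp
  also have "ennreal (\<gamma>0 c) * emeasure (disc_lborel \<rho>) (space (disc_lborel \<rho>)) + ennreal (\<eta>0 c) * (ennreal C * \<dots>) < \<infinity>"
    using L.emeasure_finite[of UNIV] L'.emeasure_finite[of UNIV]
    by (simp add: less_top[symmetric] ennreal_mult_eq_top_iff)
  finally show ?thesis
    using mh by (auto intro!: integrableI_bounded simp: split_beta')
qed

lemma control_problem:
  assumes d: "d \<in> open_interval dmin dmax"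
  shows "control_problem M F (D d) (open_interval dmin dmax) g gc \<rho> qp qm"
proof unfold_locales
  show "integrable (M \<Otimes>\<^sub>M disc_lborel \<rho>) (\<lambda>(\<omega>, t). g c (D d (max 0 t) \<omega>))" for c
    by (rule integrable_demand[OF d g_cont]) (use g_growth[of _ c] in \<open>simp add: abs_le_iff; smt (verit)\<close>)
  show "integrable (M \<Otimes>\<^sub>M disc_lborel \<rho>) (\<lambda>(\<omega>, t). gc c (D d (max 0 t) \<omega>))" for c
    by (rule integrable_demand[OF d gc_cont]) (use g_growth[of _ c] in \<open>simp add: abs_le_iff; smt (verit)\<close>)
  show "sets (F t) = (\<Inter>u\<in>{t<..}. sets (F u))" if "t < \<infinity>" for t
    using usual that by (simp add: usual_conditions_def)
qed (use F_sub demand[OF d] open_open_interval g_nonneg g_cont g_convex g_deriv gc_cont rho q_pos in auto)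

end

section \<open>Value of the game and the final theorem\<close>

lemma dynkin_has_valueI:
  assumes \<sigma>': "stopping_time F \<sigma>'" and \<tau>': "stopping_time F \<tau>'"
    and saddle: "\<And>\<sigma> \<tau>. stopping_time F \<sigma> \<Longrightarrow> stopping_time F \<tau> \<Longrightarrow>
      dynkin_payoff M \<rho> qp qm gc (D d) c \<sigma>' \<tau> \<le> dynkin_payoff M \<rho> qp qm gc (D d) c \<sigma> \<tau>'"
  shows "dynkin_has_value M F \<rho> qp qm gc D c d (dynkin_payoff M \<rho> qp qm gc (D d) c \<sigma>' \<tau>')"
proof -
  let ?J = "\<lambda>\<sigma> \<tau>. ereal (dynkin_payoff M \<rho> qp qm gc (D d) c \<sigma> \<tau>)"
  \<comment> \<open>Weak duality holds for every payoff; the saddle pair supplies the reverse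
    inequality through its own payoff.\<close>
  have "dynkin_lower M F \<rho> qp qm gc D c d \<le> dynkin_upper M F \<rho> qp qm gc D c d"
    unfolding dynkin_lower_def dynkin_upper_def
    by (intro SUP_least INF_greatest) (meson INF_lower SUP_upper order_trans)
  moreover have "dynkin_upper M F \<rho> qp qm gc D c d \<le> ?J \<sigma>' \<tau>'"
    unfolding dynkin_upper_def
    by (rule INF_lower2[of \<sigma>']) (use assms in \<open>auto intro!: SUP_least\<close>)
  moreover have "?J \<sigma>' \<tau>' \<le> dynkin_lower M F \<rho> qp qm gc D c d"
    unfolding dynkin_lower_def
    by (rule SUP_upper2[of \<tau>']) (use assms in \<open>auto intro!: INF_greatest\<close>)
  ultimately show ?thesis unfolding dynkin_has_value_def by (auto intro: antisym order_trans)
qed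

theorem proposition3p3:
  fixes M :: "'a measure" and F :: "ennreal \<Rightarrow> 'a measure"
    and W :: "real \<Rightarrow> 'a \<Rightarrow> real" and dmin dmax :: ereal
    and \<mu> \<Sigma> :: "real \<Rightarrow> real" and D :: "real \<Rightarrow> real \<Rightarrow> 'a \<Rightarrow> real"
    and g gc :: "real \<Rightarrow> real \<Rightarrow> real" and \<gamma>0 \<eta>0 :: "real \<Rightarrow> real"
    and \<nu> K0 K1 \<rho> qp qm :: real
  assumes setting: "capacity_setting M F W dmin dmax \<mu> \<Sigma> D g gc \<gamma>0 \<eta>0 \<nu> K0 K1 \<rho> qp qm"
    and optimal_exists: "\<And>c d. d \<in> open_interval dmin dmax \<Longrightarrow>
          \<exists>I\<in>controls M F. total_cost M \<rho> qp qm g (D d) c I = value_fun M F \<rho> qp qm g D c d"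
  shows "(\<forall>c. \<forall>d\<in>open_interval dmin dmax. \<forall>I\<in>controls M F.
            value_fun M F \<rho> qp qm g D c d = total_cost M \<rho> qp qm g (D d) c I \<longrightarrow>
            (let \<sigma>' = (\<lambda>\<omega>. first_positive_time (neg_variation (\<lambda>t. I t \<omega>)));
                 \<tau>' = (\<lambda>\<omega>. first_positive_time (pos_variation (\<lambda>t. I t \<omega>)));
                 J = dynkin_payoff M \<rho> qp qm gc (D d) c
             in stopping_time F \<sigma>' \<and> stopping_time F \<tau>' \<and>
                (\<forall>\<sigma> \<tau>. stopping_time F \<sigma> \<longrightarrow> stopping_time F \<tau> \<longrightarrow>
                   J \<sigma>' \<tau> \<le> J \<sigma>' \<tau>' \<and> J \<sigma>' \<tau>' \<le> J \<sigma> \<tau>')))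
         \<and> (\<forall>c. \<forall>d\<in>open_interval dmin dmax.
              value_fun M F \<rho> qp qm g D c d < \<infinity> \<and>
              (\<exists>w. dynkin_has_value M F \<rho> qp qm gc D c d w \<and>
                   ((\<lambda>x. enn2real (value_fun M F \<rho> qp qm g D x d)) has_real_derivative w) (at c)))"
proof -
  interpret capacity_setting M F W dmin dmax \<mu> \<Sigma> D g gc \<gamma>0 \<eta>0 \<nu> K0 K1 \<rho> qp qm by (rule setting)
  have saddle: "stopping_time F \<sigma>' \<and> stopping_time F \<tau>' \<and>
      (\<forall>\<sigma> \<tau>. stopping_time F \<sigma> \<longrightarrow> stopping_time F \<tau> \<longrightarrow>
        dynkin_payoff M \<rho> qp qm gc (D d) c \<sigma>' \<tau> \<le> dynkin_payoff M \<rho> qp qm gc (D d) c \<sigma> \<tau>') \<and>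
      value_fun M F \<rho> qp qm g D c d < \<infinity> \<and>
      ((\<lambda>x. enn2real (value_fun M F \<rho> qp qm g D x d)) has_real_derivative
        dynkin_payoff M \<rho> qp qm gc (D d) c \<sigma>' \<tau>') (at c)"
    if d: "d \<in> open_interval dmin dmax" and I: "I \<in> controls M F"
      and opt: "value_fun M F \<rho> qp qm g D c d = total_cost M \<rho> qp qm g (D d) c I"
      and \<sigma>': "\<sigma>' = (\<lambda>\<omega>. first_positive_time (neg_variation (\<lambda>t. I t \<omega>)))"
      and \<tau>': "\<tau>' = (\<lambda>\<omega>. first_positive_time (pos_variation (\<lambda>t. I t \<omega>)))" for c d I \<sigma>' \<tau>'
  proof -
    interpret P: control_problem M F "D d" "open_interval dmin dmax" g gc \<rho> qp qm
      by (rule control_problem[OF d])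
    have val: "P.val x = value_fun M F \<rho> qp qm g D x d" for x
      by (simp add: P.val_def value_fun_def)
    have ex: "\<exists>I\<in>controls M F. P.val x = P.cost x I" for x
      using optimal_exists[OF d, of x] unfolding val by metis
    note * = P.saddle_point[OF ex I, of c, unfolded val, OF opt, folded \<sigma>' \<tau>']
    show ?thesis using * P.val_finite[of c] unfolding val by blast
  qed
  show ?thesis
  proof (intro conjI allI ballI impI)
    fix c d I assume "d \<in> open_interval dmin dmax" "I \<in> controls M F"
      "value_fun M F \<rho> qp qm g D c d = total_cost M \<rho> qp qm g (D d) c I"
    from saddle[OF this refl refl]
    show "let \<sigma>' = (\<lambda>\<omega>. first_positive_time (neg_variation (\<lambda>t. I t \<omega>)));
                 \<tau>' = (\<lambda>\<omega>. first_positive_time (pos_variation (\<lambda>t. I t \<omega>)));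
                 J = dynkin_payoff M \<rho> qp qm gc (D d) c
             in stopping_time F \<sigma>' \<and> stopping_time F \<tau>' \<and>
                (\<forall>\<sigma> \<tau>. stopping_time F \<sigma> \<longrightarrow> stopping_time F \<tau> \<longrightarrow>
                   J \<sigma>' \<tau> \<le> J \<sigma>' \<tau>' \<and> J \<sigma>' \<tau>' \<le> J \<sigma> \<tau>')"
      unfolding Let_def by blast
  next
    fix c d assume d: "d \<in> open_interval dmin dmax"
    \<comment> \<open>Any optimal control at \<open>(c, d)\<close> will do: the payoff of its saddle
      pair is the witness for \<open>w\<close>.\<close>
    obtain I where I: "I \<in> controls M F"
      "value_fun M F \<rho> qp qm g D c d = total_cost M \<rho> qp qm g (D d) c I"
      using optimal_exists[OF d, of c] by metis
    note * = saddle[OF d I refl refl]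
    show "value_fun M F \<rho> qp qm g D c d < \<infinity>" using * by blast
    show "\<exists>w. dynkin_has_value M F \<rho> qp qm gc D c d w \<and>
        ((\<lambda>x. enn2real (value_fun M F \<rho> qp qm g D x d)) has_real_derivative w) (at c)"
      using * by (intro exI conjI) (auto intro!: dynkin_has_valueI)
  qed
qed

end
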